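(* Let $E$ be a Banach lattice and let $X$ be a non-zero Banach space. The following are equivalent: (1) $E'$ is order continuous; (2) every continuous operator $T\colon E\to X$ is unbounded continuous; (3) every continuous operator $T\colon E\to X$ is sequentially unbounded continuous.
   Context: Operators are linear. $E^+$ denotes the positive cone of $E$ and $E'$ its norm dual, which is a Banach lattice. A Banach lattice is called order continuous if its norm is order continuous. A net (or sequence) $(x_\alpha)$ in $E$ is $uaw$-convergent to $x\in E$, written $x_\alpha\xrightarrow{uaw}x$, if $|x_\alpha-x|\wedge u\to0$ weakly for every $u\in E^+$. A continuous operator $T\colon E\to X$ into a Banach space $X$ is unbounded continuous if for every norm bounded net $(x_\alpha)\subset E$, $x_\alpha\xrightarrow{uaw}0$ implies $T(x_\alpha)\to0$ weakly; it is sequentially unbounded continuous if this property holds for norm bounded sequences. *)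

theory Defs
  imports "HOL-Analysis.Analysis" "HOL-Library.Lattice_Algebras"
begin

class banach_lattice = banach + ordered_real_vector + lattice_ab_group_add_abs +
  assumes norm_lattice_mono: "\<bar>x\<bar> \<le> \<bar>y\<bar> \<Longrightarrow> norm x \<le> norm y"

instance real :: banach_lattice
  by standard simp


text \<open>
  The norm dual of \<open>E\<close> is the space of bounded linear functionals on \<open>E\<close> with the operator norm,
  ordered by \<open>f \<le> g\<close> iff \<open>f x \<le> g x\<close> for all \<open>x\<close> in the positive cone of \<open>E\<close>.
\<close>

lemma blinfun_eqI_positive:
  fixes f g :: "'a::banach_lattice \<Rightarrow>\<^sub>L 'b::real_normed_vector"
  assumes "\<And>x. 0 \<le> x \<Longrightarrow> f x = g x"
  shows "f = g"
proof (rule blinfun_eqI)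
  fix x :: 'a
  have p: "0 \<le> sup x 0" and n: "0 \<le> - inf x 0" by simp_all
  have "x = sup x 0 - (- inf x 0)"
    using add_eq_inf_sup[of x 0] by (simp add: add.commute)
  then have "f x = f (sup x 0) - f (- inf x 0)" "g x = g (sup x 0) - g (- inf x 0)"
    by (metis blinfun.diff_right)+
  then show "f x = g x" using assms[OF p] assms[OF n] by simp
qed

instantiation blinfun ::
  (banach_lattice, "{real_normed_vector, ordered_real_vector}") ordered_real_vector
begin

definition less_eq_blinfun :: "'a \<Rightarrow>\<^sub>L 'b \<Rightarrow> 'a \<Rightarrow>\<^sub>L 'b \<Rightarrow> bool"
  where "less_eq_blinfun f g \<longleftrightarrow> (\<forall>x\<ge>0. f x \<le> g x)"

definition less_blinfun :: "'a \<Rightarrow>\<^sub>L 'b \<Rightarrow> 'a \<Rightarrow>\<^sub>L 'b \<Rightarrow> bool"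
  where "less_blinfun f g \<longleftrightarrow> f \<le> g \<and> \<not> g \<le> f"

instance
proof
  fix f g :: "'a \<Rightarrow>\<^sub>L 'b"
  assume "f \<le> g" "g \<le> f"
  then show "f = g"
    by (intro blinfun_eqI_positive) (auto simp: less_eq_blinfun_def intro: antisym)
qed (auto simp: less_eq_blinfun_def less_blinfun_def blinfun.add_left blinfun.scaleR_left
       scaleR_left_mono intro: order_trans scaleR_right_mono)

end


text \<open>
  A net is a family indexed by a set \<open>I\<close> that is directed by a preorder \<open>le\<close>; it converges if it
  converges along the filter of tails of \<open>I\<close>.
\<close>

definition directed_index :: "'i set \<Rightarrow> ('i \<Rightarrow> 'i \<Rightarrow> bool) \<Rightarrow> bool"
  where "directed_index I le \<longleftrightarrow>
    I \<noteq> {} \<and> (\<forall>i\<in>I. le i i) \<and>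
    (\<forall>i\<in>I. \<forall>j\<in>I. \<forall>k\<in>I. le i j \<longrightarrow> le j k \<longrightarrow> le i k) \<and>
    (\<forall>i\<in>I. \<forall>j\<in>I. \<exists>k\<in>I. le i k \<and> le j k)"

definition tails :: "'i set \<Rightarrow> ('i \<Rightarrow> 'i \<Rightarrow> bool) \<Rightarrow> 'i filter"
  where "tails I le = (INF i\<in>I. principal {j \<in> I. le i j})"

lemma eventually_tails:
  assumes "directed_index I le"
  shows "eventually P (tails I le) \<longleftrightarrow> (\<exists>i\<in>I. \<forall>j\<in>I. le i j \<longrightarrow> P j)"
proof -
  have "eventually P (tails I le) \<longleftrightarrow>
      (\<exists>i\<in>I. eventually P (principal {j \<in> I. le i j}))"
    unfolding tails_def
  proof (rule eventually_INF_base)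
    show "I \<noteq> {}" using assms by (simp add: directed_index_def)
  next
    fix a b assume ab: "a \<in> I" "b \<in> I"
    then obtain k where k: "k \<in> I" "le a k" "le b k"
      using assms unfolding directed_index_def by meson
    have "{j \<in> I. le k j} \<subseteq> {j \<in> I. le a j} \<inter> {j \<in> I. le b j}"
      using assms ab k unfolding directed_index_def by blast
    then show "\<exists>x\<in>I. principal {j \<in> I. le x j} \<le>
        inf (principal {j \<in> I. le a j}) (principal {j \<in> I. le b j})"
      using k(1) by auto
  qed
  then show ?thesis by (auto simp: eventually_principal)
qed


definition decreasing_to_zero ::
    "'i set \<Rightarrow> ('i \<Rightarrow> 'i \<Rightarrow> bool) \<Rightarrow> ('i \<Rightarrow> 'a::ordered_real_vector) \<Rightarrow> bool"
  where "decreasing_to_zero I le x \<longleftrightarrow>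
    (\<forall>i\<in>I. \<forall>j\<in>I. le i j \<longrightarrow> x j \<le> x i) \<and>
    (\<forall>i\<in>I. 0 \<le> x i) \<and> (\<forall>z. (\<forall>i\<in>I. z \<le> x i) \<longrightarrow> z \<le> 0)"

text \<open>
  The norm is order continuous if \<open>x\<^sub>i \<down> 0\<close> implies \<open>\<parallel>x\<^sub>i\<parallel> \<longrightarrow> 0\<close> for every net.
  HOL cannot quantify over index types inside a formula; taking the space itself as the index type
  is no restriction, by the lemma below. The definition only refers to the order and the norm.
\<close>

definition order_continuous_norm :: "'a::{real_normed_vector, ordered_real_vector} itself \<Rightarrow> bool"
  where "order_continuous_norm _ \<longleftrightarrow>
    (\<forall>(I :: 'a set) le (x :: 'a \<Rightarrow> 'a). directed_index I le \<longrightarrow> decreasing_to_zero I le x \<longrightarrow>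
      ((\<lambda>i. norm (x i)) \<longlongrightarrow> 0) (tails I le))"

lemma order_continuous_norm_net:
  fixes I :: "'i set" and x :: "'i \<Rightarrow> 'a::{real_normed_vector, ordered_real_vector}"
  assumes oc: "order_continuous_norm TYPE('a)"
    and I: "directed_index I le" and x: "decreasing_to_zero I le x"
  shows "((\<lambda>i. norm (x i)) \<longlongrightarrow> 0) (tails I le)"
proof -
  let ?J = "x ` I" and ?ge = "\<lambda>a b :: 'a. b \<le> a"
  have J: "directed_index ?J ?ge"
    unfolding directed_index_def
  proof (intro conjI ballI impI)
    show "?J \<noteq> {}" using I by (simp add: directed_index_def)
  next
    fix a b assume "a \<in> ?J" "b \<in> ?J"
    then obtain i j where ij: "i \<in> I" "j \<in> I" "a = x i" "b = x j" by auto
    then obtain k where "k \<in> I" "le i k" "le j k"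
      using I unfolding directed_index_def by meson
    then show "\<exists>c\<in>?J. c \<le> a \<and> c \<le> b"
      using x ij unfolding decreasing_to_zero_def by blast
  qed auto
  have "decreasing_to_zero ?J ?ge (\<lambda>y. y)"
    using x unfolding decreasing_to_zero_def by auto
  with oc J have lim: "((\<lambda>y. norm y) \<longlongrightarrow> 0) (tails ?J ?ge)"
    unfolding order_continuous_norm_def by blast
  show ?thesis
  proof (rule tendstoI)
    fix e :: real assume "0 < e"
    with lim have "eventually (\<lambda>y. dist (norm y) 0 < e) (tails ?J ?ge)" by (rule tendstoD)
    then obtain i where i: "i \<in> I" "\<forall>y\<in>?J. y \<le> x i \<longrightarrow> dist (norm y) 0 < e"
      unfolding eventually_tails[OF J] by auto
    have "\<forall>j\<in>I. le i j \<longrightarrow> dist (norm (x j)) 0 < e"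
      using i x unfolding decreasing_to_zero_def by blast
    with i(1) show "eventually (\<lambda>j. dist (norm (x j)) 0 < e) (tails I le)"
      unfolding eventually_tails[OF I] by blast
  qed
qed


definition weakly_tendsto :: "('i \<Rightarrow> 'a::real_normed_vector) \<Rightarrow> 'a \<Rightarrow> 'i filter \<Rightarrow> bool"
  where "weakly_tendsto x l F \<longleftrightarrow>
    (\<forall>f :: 'a \<Rightarrow>\<^sub>L real. ((\<lambda>i. f (x i)) \<longlongrightarrow> f l) F)"

definition uaw_tendsto :: "('i \<Rightarrow> 'a::banach_lattice) \<Rightarrow> 'a \<Rightarrow> 'i filter \<Rightarrow> bool"
  where "uaw_tendsto x l F \<longleftrightarrow> (\<forall>u\<ge>0. weakly_tendsto (\<lambda>i. inf \<bar>x i - l\<bar> u) 0 F)"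

text \<open>
  Again the index type of the nets has to be fixed; \<open>'a \<times> 'a set\<close> is large enough to cover nets
  over every index type, by the lemma below.
\<close>

definition unbounded_continuous :: "('a::banach_lattice \<Rightarrow>\<^sub>L 'b::banach) \<Rightarrow> bool"
  where "unbounded_continuous T \<longleftrightarrow>
    (\<forall>(I :: ('a \<times> 'a set) set) le x.
      directed_index I le \<longrightarrow> bounded (x ` I) \<longrightarrow> uaw_tendsto x 0 (tails I le) \<longrightarrow>
      weakly_tendsto (\<lambda>i. T (x i)) 0 (tails I le))"

definition sequentially_unbounded_continuous :: "('a::banach_lattice \<Rightarrow>\<^sub>L 'b::banach) \<Rightarrow> bool"
  where "sequentially_unbounded_continuous T \<longleftrightarrow>
    (\<forall>x :: nat \<Rightarrow> 'a. bounded (range x) \<longrightarrow> uaw_tendsto x 0 sequentially \<longrightarrow>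
      weakly_tendsto (\<lambda>n. T (x n)) 0 sequentially)"

lemma unbounded_continuous_net:
  fixes T :: "'a::banach_lattice \<Rightarrow>\<^sub>L 'b::banach" and I :: "'i set" and x :: "'i \<Rightarrow> 'a"
  assumes T: "unbounded_continuous T" and I: "directed_index I le"
    and bdd: "bounded (x ` I)" and uaw: "uaw_tendsto x 0 (tails I le)"
  shows "weakly_tendsto (\<lambda>i. T (x i)) 0 (tails I le)"
proof -
  define A where "A i = x ` {j \<in> I. le i j}" for i
  define J where "J = {(y, B). \<exists>i\<in>I. B = A i \<and> y \<in> B}"
  define leJ where "leJ p q \<longleftrightarrow> snd q \<subseteq> snd p" for p q :: "'a \<times> 'a set"
  have le_refl: "le i i" if "i \<in> I" for i
    using that I unfolding directed_index_def by blast
  have le_trans: "le i k" if "i \<in> I" "j \<in> I" "k \<in> I" "le i j" "le j k" for i j k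
    using that I unfolding directed_index_def by blast
  have inJ: "(x i, A i) \<in> J" if "i \<in> I" for i
    using that le_refl[OF that] unfolding J_def A_def by auto
  have Amono: "A k \<subseteq> A i" if "i \<in> I" "k \<in> I" "le i k" for i k
    using that le_trans unfolding A_def by blast
  have J: "directed_index J leJ"
    unfolding directed_index_def
  proof (intro conjI ballI impI)
    have "I \<noteq> {}" using I by (simp add: directed_index_def)
    then show "J \<noteq> {}" using inJ by blast
  next
    fix p q assume "p \<in> J" "q \<in> J"
    then obtain i j where ij: "i \<in> I" "j \<in> I" "snd p = A i" "snd q = A j"
      unfolding J_def by auto
    then obtain k where "k \<in> I" "le i k" "le j k"
      using I unfolding directed_index_def by meson
    then show "\<exists>r\<in>J. leJ p r \<and> leJ q r"
      using ij Amono inJ[of k] unfolding leJ_def by (intro bexI[of _ "(x k, A k)"]) auto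
  qed (auto simp: leJ_def)
  have tails_eq: "filtermap fst (tails J leJ) = filtermap x (tails I le)"
  proof (rule filter_eqI)
    fix P :: "'a \<Rightarrow> bool"
    have "(\<exists>p\<in>J. \<forall>q\<in>J. leJ p q \<longrightarrow> P (fst q)) \<longleftrightarrow> (\<exists>i\<in>I. \<forall>j\<in>I. le i j \<longrightarrow> P (x j))"
    proof
      assume "\<exists>p\<in>J. \<forall>q\<in>J. leJ p q \<longrightarrow> P (fst q)"
      then obtain p where p: "p \<in> J" "\<forall>q\<in>J. leJ p q \<longrightarrow> P (fst q)" by blast
      then obtain i where i: "i \<in> I" "snd p = A i" unfolding J_def by auto
      have "P (x j)" if "j \<in> I" "le i j" for j
        using p(2) inJ[OF that(1)] Amono[OF i(1) that] i(2) unfolding leJ_def by force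
      with i(1) show "\<exists>i\<in>I. \<forall>j\<in>I. le i j \<longrightarrow> P (x j)" by blast
    next
      assume "\<exists>i\<in>I. \<forall>j\<in>I. le i j \<longrightarrow> P (x j)"
      then obtain i where i: "i \<in> I" "\<forall>j\<in>I. le i j \<longrightarrow> P (x j)" by blast
      then have "\<forall>q\<in>J. leJ (x i, A i) q \<longrightarrow> P (fst q)"
        unfolding J_def leJ_def A_def by fastforce
      with inJ[OF i(1)] show "\<exists>p\<in>J. \<forall>q\<in>J. leJ p q \<longrightarrow> P (fst q)" by blast
    qed
    then show "eventually P (filtermap fst (tails J leJ)) \<longleftrightarrow>
        eventually P (filtermap x (tails I le))"
      by (simp add: eventually_filtermap eventually_tails[OF I] eventually_tails[OF J])
  qed
  have transfer: "((\<lambda>p. g (fst p)) \<longlongrightarrow> c) (tails J leJ) \<longleftrightarrow>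
      ((\<lambda>i. g (x i)) \<longlongrightarrow> c) (tails I le)" for g :: "'a \<Rightarrow> real" and c
    using tails_eq filterlim_filtermap[of g "nhds c" fst "tails J leJ"]
      filterlim_filtermap[of g "nhds c" x "tails I le"] by simp
  have "fst ` J \<subseteq> x ` I" unfolding J_def A_def by auto
  with bdd have "bounded (fst ` J)" by (rule bounded_subset)
  moreover have "uaw_tendsto fst 0 (tails J leJ)"
    using uaw transfer[of "\<lambda>y. blinfun_apply _ (inf \<bar>y - 0\<bar> _)"]
    unfolding uaw_tendsto_def weakly_tendsto_def by simp
  ultimately have "weakly_tendsto (\<lambda>p. T (fst p)) 0 (tails J leJ)"
    using T J unfolding unbounded_continuous_def by blast
  then show ?thesis
    using transfer[of "\<lambda>y. blinfun_apply _ (T y)"] unfolding weakly_tendsto_def by simp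
qed

end

theory Submission
  imports Defs
begin

text \<open>
  All three conditions are equivalent to the following: for every positive functional \<open>f\<close> and
  every bounded disjoint positive sequence \<open>w\<close> one has \<open>f (w n) \<longlonglongrightarrow> 0\<close>. A disjointification
  argument turns this into: for every \<open>\<epsilon>\<close> there is \<open>u \<ge> 0\<close> with \<open>f ((x - u)\<^sup>+) \<le> \<epsilon>\<close> for all
  \<open>x \<ge> 0\<close> in the unit ball. Splitting \<open>\<bar>x\<bar> = \<bar>x\<bar> \<and> u + (\<bar>x\<bar> - u)\<^sup>+\<close>, the latter condition gives that
  all operators are unbounded continuous, and also that the dual is order continuous, since a
  decreasing net of functionals with infimum \<open>0\<close> tends to \<open>0\<close> at \<open>u\<close>. The disjointness condition
  follows from order continuity of the dual by restricting \<open>f\<close> to the ideals generated by initial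
  segments of \<open>w\<close>, and from sequential unbounded continuity because disjoint sequences are
  \<open>uaw\<close>-null, applied to rank one operators.
\<close>

section \<open>Sublinear functionals\<close>

text \<open>Homogeneity is asked only as an inequality, which is all that the infimum constructions
  below have to verify; rescaling by \<open>1 / c\<close> gives equality. The case
  \<open>c = 0\<close> together with subadditivity forces \<open>p 0 = 0\<close>.\<close>

definition sublinear :: "('a::real_vector \<Rightarrow> real) \<Rightarrow> bool"
  where "sublinear p \<longleftrightarrow>
    (\<forall>x y. p (x + y) \<le> p x + p y) \<and> (\<forall>c\<ge>0. \<forall>x. p (c *\<^sub>R x) \<le> c * p x)"

lemma sublinear_add: "sublinear p \<Longrightarrow> p (x + y) \<le> p x + p y"
  by (simp add: sublinear_def)

lemma sublinear_zero:
  assumes "sublinear p"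
  shows "p 0 = 0"
proof -
  have "p (0 *\<^sub>R 0) \<le> 0 * p 0" using assms unfolding sublinear_def by blast
  then show ?thesis using sublinear_add[OF assms, of 0 0] by simp
qed

lemma sublinear_scale:
  assumes "sublinear p" "0 \<le> c"
  shows "p (c *\<^sub>R x) = c * p x"
proof (cases "c = 0")
  case True
  then show ?thesis using sublinear_zero assms(1) by simp
next
  case False
  with assms have c: "0 < c" by simp
  have "p ((1 / c) *\<^sub>R (c *\<^sub>R x)) \<le> (1 / c) * p (c *\<^sub>R x)"
    using assms(1) c unfolding sublinear_def by (meson less_imp_le zero_less_divide_1_iff)
  then have "c * p x \<le> p (c *\<^sub>R x)" using c by (simp add: field_simps)
  moreover have "p (c *\<^sub>R x) \<le> c * p x" using assms unfolding sublinear_def by blast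
  ultimately show ?thesis by simp
qed

lemma sublinear_minus: "sublinear p \<Longrightarrow> - p (- x) \<le> p x"
  using sublinear_add[of p x "- x"] sublinear_zero[of p] by simp

lemma sublinear_norm: "sublinear norm"
  unfolding sublinear_def by (simp add: norm_triangle_ineq)

text \<open>\<open>q\<close> is the infimum over \<open>t \<ge> 0\<close> of
  \<open>p (x + t *\<^sub>R y) - t * p y\<close>: taking \<open>t = 0\<close> gives
  \<open>q \<le> p\<close>, and \<open>t = 1\<close> at \<open>- y\<close> gives the last bound. If
  \<open>p\<close> is minimal, then \<open>q = p\<close> and \<open>p\<close> is odd at
  \<open>y\<close>.\<close>

lemma sublinear_tilt:
  fixes p :: "'a::real_vector \<Rightarrow> real"
  assumes p: "sublinear p"
  obtains q where "sublinear q" "\<And>x. q x \<le> p x" "q (- y) \<le> - p y"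
proof -
  define r where "r t x = p (x + t *\<^sub>R y) - t * p y" for t x
  define q where "q x = (INF t\<in>{0..}. r t x)" for x
  \<comment> \<open>A lower bound independent of \<open>t\<close> keeps the infimum finite.\<close>
  have "- p (- x) \<le> r t x" if "0 \<le> t" for t x
    using sublinear_add[OF p, of "x + t *\<^sub>R y" "- x"] sublinear_scale[OF p that, of y]
    by (simp add: r_def)
  then have bdd: "bdd_below ((\<lambda>t. r t x) ` {0..})" for x by (intro bdd_belowI) auto
  have q_le: "q x \<le> r t x" if "0 \<le> t" for t x
    unfolding q_def using that by (intro cINF_lower[OF bdd]) simp
  have q_ge: "b \<le> q x" if "\<And>t. 0 \<le> t \<Longrightarrow> b \<le> r t x" for b x
    unfolding q_def using that by (intro cINF_greatest) auto
  have "q (x + z) \<le> q x + q z" for x z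
  proof -
    \<comment> \<open>\<open>t\<close> and \<open>s\<close> vary independently here, so the infimum
      can be taken over one after the other.\<close>
    have "q (x + z) \<le> r t x + r s z" if "0 \<le> t" "0 \<le> s" for t s
    proof -
      have "q (x + z) \<le> r (t + s) (x + z)" using q_le that by simp
      also have "\<dots> \<le> r t x + r s z"
        using sublinear_add[OF p, of "x + t *\<^sub>R y" "z + s *\<^sub>R y"]
        by (simp add: r_def algebra_simps)
      finally show ?thesis .
    qed
    note add = this
    have "q (x + z) - r t x \<le> q z" if "0 \<le> t" for t
      by (rule q_ge) (use add[OF that] in \<open>simp add: diff_le_eq add.commute\<close>)
    then have "q (x + z) - q z \<le> r t x" if "0 \<le> t" for t
      using that by (simp add: diff_le_eq le_diff_eq add.commute)
    then have "q (x + z) - q z \<le> q x" by (rule q_ge)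
    then show ?thesis by simp
  qed
  moreover have "q (c *\<^sub>R x) \<le> c * q x" if "0 \<le> c" for c x
  proof (cases "c = 0")
    case True
    then show ?thesis using q_le[of 0 0] sublinear_zero[OF p] by (simp add: r_def)
  next
    case False
    with that have c: "0 < c" by simp
    have "q (c *\<^sub>R x) / c \<le> q x"
    proof (rule q_ge)
      fix t :: real assume t: "0 \<le> t"
      have "q (c *\<^sub>R x) \<le> r (c * t) (c *\<^sub>R x)" using q_le c t by simp
      also have "\<dots> = c * r t x"
        using sublinear_scale[OF p that, of "x + t *\<^sub>R y"] by (simp add: r_def algebra_simps)
      finally show "q (c *\<^sub>R x) / c \<le> r t x" using c by (simp add: field_simps)
    qed
    then show ?thesis using c by (simp add: field_simps)
  qed
  ultimately have "sublinear q" by (simp add: sublinear_def)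
  moreover have "q x \<le> p x" for x using q_le[of 0 x] by (simp add: r_def)
  moreover have "q (- y) \<le> - p y"
    using q_le[of 1 "- y"] sublinear_zero[OF p] by (simp add: r_def)
  ultimately show ?thesis by (rule that)
qed

text \<open>
  The Hahn-Banach theorem: a minimal sublinear functional cannot be tilted any further in any
  direction, hence it is linear.
\<close>

theorem sublinear_ge_linear:
  fixes p :: "'a::real_vector \<Rightarrow> real"
  assumes p: "sublinear p"
  obtains g where "linear g" "\<And>x. g x \<le> p x"
proof -
  define A where "A = {q. sublinear q \<and> q \<le> p}"
  \<comment> \<open>The order is reversed, so that the maximal elements of Zorn's lemma are minimal
    functionals.\<close>
  define R where "R = relation_of (\<lambda>q r :: 'a \<Rightarrow> real. r \<le> q) A"
  have po: "partial_order_on A R"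
    unfolding R_def by (rule partial_order_on_relation_ofI) auto
  have "\<exists>u\<in>A. \<forall>q\<in>C. u \<le> q" if C: "C \<in> Chains R" for C
  proof (cases "C = {}")
    case True
    then show ?thesis using p by (auto simp: A_def)
  next
    case False
    have CA: "q \<in> A" if "q \<in> C" for q
      using C that unfolding Chains_def R_def relation_of_def by blast
    have lin: "q \<le> r \<or> r \<le> q" if "q \<in> C" "r \<in> C" for q r
      using C that unfolding Chains_def R_def relation_of_def by blast
    have sub: "sublinear q" and qp: "q x \<le> p x" if "q \<in> C" for q x
      using CA[OF that] by (auto simp: A_def le_fun_def)
    define u where "u x = (INF q\<in>C. q x)" for x
    have "- p (- x) \<le> q x" if "q \<in> C" for q x
      using sublinear_minus[OF sub[OF that], of x] qp[OF that, of "- x"] by simp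
    then have bdd: "bdd_below ((\<lambda>q. q x) ` C)" for x by (intro bdd_belowI) auto
    have u_le: "u x \<le> q x" if "q \<in> C" for q x
      unfolding u_def using that by (intro cINF_lower[OF bdd])
    have u_ge: "b \<le> u x" if "\<And>q. q \<in> C \<Longrightarrow> b \<le> q x" for b x
      unfolding u_def using that False by (intro cINF_greatest) auto
    have "u (x + y) \<le> u x + u y" for x y
    proof -
      \<comment> \<open>Of two members of the chain, subadditivity of the smaller one gives the
        mixed bound.\<close>
      have "u (x + y) \<le> q x + r y" if q: "q \<in> C" and r: "r \<in> C" for q r
        using lin[OF q r]
      proof
        assume "q \<le> r"
        then show ?thesis
          using u_le[OF q, of "x + y"] sublinear_add[OF sub[OF q], of x y] le_funD[of q r y]
          by simp
      next
        assume "r \<le> q"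
        then show ?thesis
          using u_le[OF r, of "x + y"] sublinear_add[OF sub[OF r], of x y] le_funD[of r q x]
          by simp
      qed
      note add = this
      have "u (x + y) - q x \<le> u y" if "q \<in> C" for q
        by (rule u_ge) (use add[OF that] in \<open>simp add: diff_le_eq add.commute\<close>)
      then have "u (x + y) - u y \<le> q x" if "q \<in> C" for q
        using that by (simp add: diff_le_eq le_diff_eq add.commute)
      then have "u (x + y) - u y \<le> u x" by (rule u_ge)
      then show ?thesis by simp
    qed
    moreover have "u (c *\<^sub>R x) \<le> c * u x" if "0 \<le> c" for c x
    proof (cases "c = 0")
      case True
      obtain q where "q \<in> C" using False by blast
      then show ?thesis using True u_le[of q 0] sublinear_zero[OF sub, of q] by simp
    next
      case False
      with that have c: "0 < c" by simp
      have "u (c *\<^sub>R x) / c \<le> u x"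
      proof (rule u_ge)
        fix q assume q: "q \<in> C"
        show "u (c *\<^sub>R x) / c \<le> q x"
          using u_le[OF q, of "c *\<^sub>R x"] sublinear_scale[OF sub[OF q] that, of x] c
          by (simp add: field_simps)
      qed
      then show ?thesis using c by (simp add: field_simps)
    qed
    ultimately have "sublinear u" by (simp add: sublinear_def)
    moreover have "u \<le> p" using False u_le qp unfolding le_fun_def by (meson ex_in_conv order_trans)
    ultimately have "u \<in> A" by (simp add: A_def)
    then show ?thesis using u_le by (auto simp: le_fun_def)
  qed
  then have "\<exists>m\<in>A. \<forall>q\<in>A. q \<le> m \<longrightarrow> q = m"
    using predicate_Zorn[of A "\<lambda>q r. r \<le> q"] po unfolding R_def by blast
  then obtain g where g: "sublinear g" "g \<le> p" and max: "\<forall>q\<in>A. q \<le> g \<longrightarrow> q = g"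
    unfolding A_def by blast
  have minimal: "q = g" if "q \<le> g" "sublinear q" for q
    using max that g(2) order_trans[OF that(1) g(2)] by (simp add: A_def)
  have neg: "g (- y) = - g y" for y
  proof -
    obtain q where "sublinear q" "\<And>x. q x \<le> g x" and q: "q (- y) \<le> - g y"
      using sublinear_tilt[OF g(1), of y] by blast
    then have "q = g" using minimal by (simp add: le_fun_def)
    then show ?thesis using q sublinear_minus[OF g(1), of y] by simp
  qed
  have "linear g"
  proof (rule linearI)
    fix x y
    have "g (- x + - y) \<le> g (- x) + g (- y)" by (rule sublinear_add[OF g(1)])
    then have "g x + g y \<le> g (x + y)" using neg[of x] neg[of y] neg[of "x + y"] by simp
    then show "g (x + y) = g x + g y" using sublinear_add[OF g(1), of x y] by simp
  next
    fix c :: real and x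
    show "g (c *\<^sub>R x) = c *\<^sub>R g x"
    proof (cases "0 \<le> c")
      case True
      then show ?thesis using sublinear_scale[OF g(1)] by simp
    next
      case False
      then have "g ((- c) *\<^sub>R x) = - c * g x" using sublinear_scale[OF g(1), of "- c" x] by simp
      then show ?thesis using neg[of "c *\<^sub>R x"] by simp
    qed
  qed
  then show ?thesis using that g(2) by (simp add: le_fun_def)
qed

text \<open>Tilting the norm at \<open>a\<close> forces every linear minorant \<open>g\<close> of
  the result to satisfy \<open>g a \<ge> norm a\<close>, while staying below the norm makes
  \<open>g\<close> bounded.\<close>

corollary blinfun_separates_zero:
  fixes a :: "'a::real_normed_vector"
  assumes "a \<noteq> 0"
  obtains h :: "'a \<Rightarrow>\<^sub>L real" where "h a \<noteq> 0"
proof -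
  obtain q :: "'a \<Rightarrow> real" where q: "sublinear q" "\<And>x. q x \<le> norm x" "q (- a) \<le> - norm a"
    using sublinear_tilt[OF sublinear_norm, of a] by blast
  obtain g where g: "linear g" "\<And>x. g x \<le> q x" using sublinear_ge_linear[OF q(1)] by blast
  have "\<bar>g x\<bar> \<le> norm x" for x
    using g(2)[of x] q(2)[of x] g(2)[of "- x"] q(2)[of "- x"] linear_neg[OF g(1), of x]
    by simp
  then have "bounded_linear g"
    using g(1) by (intro bounded_linear_intro[of g 1]) (auto simp: linear_add linear_scale)
  then have "blinfun_apply (Blinfun g) = g" by (rule bounded_linear_Blinfun_apply)
  moreover have "g a \<noteq> 0"
    using g(2)[of "- a"] q(3) assms linear_neg[OF g(1), of a] by (smt (verit) zero_less_norm_iff)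
  ultimately show ?thesis using that by metis
qed

section \<open>Vector lattices\<close>

lemma norm_abs_lattice: "norm \<bar>x\<bar> = norm (x :: 'a::banach_lattice)"
  by (intro antisym norm_lattice_mono) simp_all

lemma norm_mono_nonneg: "0 \<le> x \<Longrightarrow> x \<le> y \<Longrightarrow> norm x \<le> norm (y :: 'a::banach_lattice)"
  by (rule norm_lattice_mono) simp

text \<open>The modulus is norm continuous because \<open>\<bar>\<bar>x i\<bar> -
  \<bar>l\<bar>\<bar> \<le> \<bar>x i - l\<bar>\<close>. So \<open>x\<close>, eventually equal to
  its own modulus, also tends to \<open>\<bar>l\<bar>\<close>.\<close>

lemma nonneg_limit:
  fixes x :: "'i \<Rightarrow> 'a::banach_lattice"
  assumes lim: "(x \<longlongrightarrow> l) F" and nonneg: "eventually (\<lambda>i. 0 \<le> x i) F" and F: "F \<noteq> bot"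
  shows "0 \<le> l"
proof -
  have dist: "((\<lambda>i. norm (x i - l)) \<longlongrightarrow> 0) F"
    using lim by (intro tendsto_norm_zero) (rule Lim_null[THEN iffD1])
  have le: "\<forall>i. norm (\<bar>x i\<bar> - \<bar>l\<bar>) \<le> norm (x i - l)"
    by (intro allI norm_lattice_mono abs_triangle_ineq3)
  have "((\<lambda>i. \<bar>x i\<bar> - \<bar>l\<bar>) \<longlongrightarrow> 0) F"
    by (rule Lim_null_comparison[OF always_eventually[OF le] dist])
  then have "((\<lambda>i. \<bar>x i\<bar>) \<longlongrightarrow> \<bar>l\<bar>) F" by (rule Lim_null[THEN iffD2])
  moreover have "eventually (\<lambda>i. \<bar>x i\<bar> = x i) F" using nonneg by eventually_elim simp
  ultimately have "(x \<longlongrightarrow> \<bar>l\<bar>) F" by (rule Lim_transform_eventually)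
  then have "l = \<bar>l\<bar>" by (rule tendsto_unique[OF F lim])
  then show ?thesis using abs_ge_zero[of l] by simp
qed

lemma abs_scaleR_le: "\<bar>c *\<^sub>R x\<bar> \<le> \<bar>c\<bar> *\<^sub>R \<bar>x :: 'a::banach_lattice\<bar>"
proof -
  have *: "\<bar>c *\<^sub>R x\<bar> \<le> c *\<^sub>R \<bar>x\<bar>" if "0 \<le> c" for c :: real and x :: 'a
    using scaleR_left_mono[OF abs_ge_self that, of x]
      scaleR_left_mono[OF abs_ge_minus_self that, of x] by (intro abs_leI) simp_all
  show ?thesis
  proof (cases "0 \<le> c")
    case True
    then show ?thesis using * by simp
  next
    case False
    then show ?thesis using *[of "- c" "- x"] by simp
  qed
qed

lemma pprt_scaleR_le:
  fixes x :: "'a::banach_lattice"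
  assumes "0 \<le> c"
  shows "pprt (c *\<^sub>R x) \<le> c *\<^sub>R pprt x"
  unfolding pprt_def
  using scaleR_left_mono[OF sup_ge1 assms, of x 0] scaleR_nonneg_nonneg[OF assms, of "sup x 0"]
  by simp

lemma pprt_minus_pprt: "pprt x - pprt (- x) = (x :: 'a::lattice_ab_group_add)"
  using prts[of x] by (simp add: pprt_neg)

lemma pprt_le_abs: "pprt x \<le> \<bar>x :: 'a::lattice_ab_group_add_abs\<bar>"
  unfolding pprt_def by (simp add: abs_ge_self)

text \<open>The part of \<open>x\<close> below \<open>u\<close> and the excess over
  \<open>u\<close>: this splitting is behind both consequences of almost order boundedness.\<close>

lemma inf_add_pprt_diff: "inf x u + pprt (x - u) = (x :: 'a::lattice_ab_group_add)"
proof -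
  have "pprt (x - u) = x + sup (- u) (- x)"
    by (simp add: pprt_def add_sup_distrib_left)
  also have "\<dots> = x - inf x u" by (simp add: diff_inf_eq_sup sup_commute)
  finally show ?thesis by (metis add.commute diff_add_cancel)
qed

lemma inf_pprt_pprt_minus: "inf (pprt x) (pprt (- x)) = (0 :: 'a::lattice_ab_group_add)"
proof -
  have "inf (pprt x) (pprt (- x)) = inf (x + pprt (- x)) (0 + pprt (- x))"
    using pprt_minus_pprt[of x] by (simp add: algebra_simps)
  also have "\<dots> = inf x 0 + pprt (- x)" by (rule add_inf_distrib_right[symmetric])
  also have "\<dots> = nprt x + - nprt x" by (simp only: pprt_neg nprt_def)
  finally show ?thesis by simp
qed

text \<open>With \<open>?z\<close> the left-hand side, \<open>?z - inf a c\<close> is the supremum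
  of \<open>?z - a\<close>, which lies below \<open>b\<close> and \<open>c\<close>, and of
  \<open>?z - c\<close>, which is nonpositive.\<close>

lemma inf_add_le:
  fixes a b c :: "'a::lattice_ab_group_add"
  assumes "0 \<le> a" "0 \<le> b" "0 \<le> c"
  shows "inf (a + b) c \<le> inf a c + inf b c"
proof -
  let ?z = "inf (a + b) c"
  have z: "?z \<le> a + b" "?z \<le> c" by simp_all
  have "?z - inf a c = sup (?z - a) (?z - c)" by (simp add: diff_inf_eq_sup add_sup_distrib_left)
  also have "\<dots> \<le> inf b c"
  proof -
    have "?z - a \<le> b" using z(1) by (simp add: diff_le_eq add.commute)
    moreover have "?z - a \<le> c" using add_mono[OF z(2) assms(1)] by (simp add: diff_le_eq)
    moreover have "?z - c \<le> 0" using z(2) by simp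
    ultimately show ?thesis using assms by (meson le_infI le_supI order_trans)
  qed
  finally show ?thesis by (simp only: diff_le_eq add.commute)
qed

lemma inf_sum_eq_0:
  fixes w :: "'i \<Rightarrow> 'a::lattice_ab_group_add"
  assumes "finite K" "\<And>k. k \<in> K \<Longrightarrow> 0 \<le> w k" "0 \<le> c" "\<And>k. k \<in> K \<Longrightarrow> inf (w k) c = 0"
  shows "inf (sum w K) c = 0"
  using assms
proof (induction K rule: finite_induct)
  case empty
  then show ?case by (simp add: inf_absorb1)
next
  case (insert k K)
  have "inf (w k + sum w K) c \<le> inf (w k) c + inf (sum w K) c"
    using insert.prems by (intro inf_add_le sum_nonneg) auto
  also have "\<dots> = 0" using insert.prems insert.IH by simp
  finally have "inf (w k + sum w K) c \<le> 0" .
  moreover have "0 \<le> inf (w k + sum w K) c"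
    using insert.prems by (intro le_infI add_nonneg_nonneg sum_nonneg) auto
  ultimately show ?case using insert.hyps by (simp add: antisym)
qed

lemma inf_scaleR_eq_0:
  fixes a c :: "'a::banach_lattice"
  assumes t: "0 \<le> t" and ac: "0 \<le> a" "0 \<le> c" "inf a c = 0"
  shows "inf (t *\<^sub>R a) c = 0"
proof -
  \<comment> \<open>A common factor for both arguments, at least \<open>t\<close> and positive even
    if \<open>t = 0\<close>; dividing by it reduces the claim to \<open>inf a c = 0\<close>.\<close>
  define s where "s = max t 1"
  let ?z = "inf (t *\<^sub>R a) c"
  have s: "0 < s" "1 \<le> s" "t \<le> s" by (auto simp: s_def)
  have "?z \<le> s *\<^sub>R a" "?z \<le> s *\<^sub>R c"
    using scaleR_right_mono[OF s(3) ac(1)] scaleR_right_mono[OF s(2) ac(2)]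
    by (auto intro: le_infI1 le_infI2)
  then have "(1 / s) *\<^sub>R ?z \<le> a" "(1 / s) *\<^sub>R ?z \<le> c"
    using s(1) scaleR_left_mono[of ?z _ "1 / s"] by fastforce+
  then have "(1 / s) *\<^sub>R ?z \<le> 0" using ac(3) by (metis le_inf_iff)
  then have "s *\<^sub>R ((1 / s) *\<^sub>R ?z) \<le> s *\<^sub>R 0" using s(1) by (intro scaleR_left_mono) simp_all
  then have "?z \<le> 0" using s(1) by simp
  moreover have "0 \<le> ?z" using t ac by (simp add: scaleR_nonneg_nonneg)
  ultimately show ?thesis by (rule antisym)
qed

text \<open>A sum of disjoint positive elements is their supremum, and each of these elements lies
  below \<open>u\<close>. This will make disjoint sequences weakly null after truncation at
  \<open>u\<close>.\<close>

lemma sum_inf_disjoint_le: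
  fixes w :: "nat \<Rightarrow> 'a::lattice_ab_group_add"
  assumes w: "\<And>n. 0 \<le> w n" and disj: "\<And>m n. m < n \<Longrightarrow> inf (w m) (w n) = 0" and u: "0 \<le> u"
  shows "(\<Sum>n<N. inf (w n) u) \<le> u"
proof (induction N)
  case 0
  then show ?case using u by simp
next
  case (Suc N)
  let ?s = "\<Sum>n<N. inf (w n) u" and ?t = "inf (w N) u"
  have pos: "0 \<le> inf (w n) u" for n using w u by simp
  have "inf ?s ?t = 0"
  proof (rule inf_sum_eq_0)
    fix n assume "n \<in> {..<N}"
    then have "inf (inf (w n) u) ?t \<le> 0"
      using disj[of n N] by (metis inf_le1 inf_mono lessThan_iff)
    then show "inf (inf (w n) u) ?t = 0" using pos by (intro antisym) simp_all
  qed (use pos in auto)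
  then have "?s + ?t = sup ?s ?t" using add_eq_inf_sup[of ?s ?t] by simp
  also have "\<dots> \<le> u" using Suc by simp
  finally show ?case by simp
qed

text \<open>\<open>y\<close> is \<open>x\<close> truncated to the interval from \<open>- a\<close>
  to \<open>a\<close>. The last two bounds keep both pieces in every order ideal containing
  \<open>x\<close>.\<close>

lemma riesz_decomposition:
  fixes x a b :: "'a::lattice_ab_group_add_abs"
  assumes x: "\<bar>x\<bar> \<le> a + b" and ab: "0 \<le> a" "0 \<le> b"
  obtains y z where "x = y + z" "\<bar>y\<bar> \<le> a" "\<bar>z\<bar> \<le> b" "\<bar>y\<bar> \<le> \<bar>x\<bar>" "\<bar>z\<bar> \<le> \<bar>x\<bar>"
proof -
  define y where "y = sup (inf x a) (- a)"
  have x': "x \<le> a + b" "- x \<le> a + b" using x by (simp_all add: abs_le_iff)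
  have na: "- a \<le> a" using ab(1) by (meson neg_le_0_iff_le order_trans)
  have y: "y \<le> a" "- a \<le> y" "inf x a \<le> y" using na by (simp_all add: y_def)
  have y1: "\<bar>y\<bar> \<le> a" using y by (intro abs_leI) (simp_all add: minus_le_iff)
  have below: "x - d \<le> y" if "0 \<le> d" "x - d \<le> a" for d
  proof -
    have "x - d \<le> x" using that by simp
    then show ?thesis using that(2) y(3) by (meson le_infI order_trans)
  qed
  have above: "y \<le> x + d" if "0 \<le> d" "- a \<le> x + d" for d
  proof -
    have "x \<le> x + d" using that by simp
    then show ?thesis unfolding y_def using that(2) by (meson inf_le1 le_supI order_trans)
  qed
  \<comment> \<open>Applied with \<open>d = b\<close> for the decomposition and with
    \<open>d = \<bar>x\<bar>\<close> for the ideal property.\<close>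
  have diff: "\<bar>x - y\<bar> \<le> d" if "0 \<le> d" "x - d \<le> a" "- a \<le> x + d" for d
    using below[OF that(1,2)] above[OF that(1,3)]
    by (intro abs_leI) (simp_all add: diff_le_eq add.commute)
  have "\<bar>x - y\<bar> \<le> b"
  proof (rule diff)
    show "x - b \<le> a" using x'(1) by (simp add: diff_le_eq)
    show "- a \<le> x + b"
      using add_left_mono[OF x'(2), of x] add_le_cancel_left[of a "- a" "x + b"]
      by (simp add: ac_simps)
  qed (rule ab(2))
  moreover have "\<bar>x - y\<bar> \<le> \<bar>x\<bar>"
  proof (rule diff)
    have "x - \<bar>x\<bar> \<le> 0" by (simp add: abs_ge_self)
    then show "x - \<bar>x\<bar> \<le> a" using ab(1) by (rule order_trans)
    have "0 \<le> x + \<bar>x\<bar>" using add_left_mono[OF abs_ge_minus_self, of x x] by simp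
    then show "- a \<le> x + \<bar>x\<bar>" using ab(1) by (meson neg_le_0_iff_le order_trans)
  qed simp
  moreover have "\<bar>y\<bar> \<le> \<bar>x\<bar>"
  proof (rule abs_leI)
    show "y \<le> \<bar>x\<bar>"
    proof -
      have "- a \<le> \<bar>x\<bar>" using ab(1) by (meson abs_ge_zero neg_le_0_iff_le order_trans)
      then show ?thesis unfolding y_def by (meson abs_ge_self inf_le1 le_supI order_trans)
    qed
    have "- \<bar>x\<bar> \<le> 0" by simp
    then have "- \<bar>x\<bar> \<le> a" using ab(1) by (rule order_trans)
    moreover have "- \<bar>x\<bar> \<le> x" using abs_ge_minus_self[of x] by (simp only: minus_le_iff)
    ultimately have "- \<bar>x\<bar> \<le> y" using y(3) by (meson le_infI order_trans)
    then show "- y \<le> \<bar>x\<bar>" by (simp add: minus_le_iff)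
  qed
  ultimately show ?thesis using y1 by (intro that[of y "x - y"]) simp_all
qed

section \<open>Functionals on Banach lattices\<close>

text \<open>The extension is defined through \<open>x = pprt x - pprt (- x)\<close>. Linearity
  reduces to the cone because the value does not depend on how \<open>x\<close> is written as a
  difference of positive elements.\<close>

lemma cone_functional_extension:
  fixes \<phi> :: "'a::banach_lattice \<Rightarrow> real"
  assumes add: "\<And>x y. 0 \<le> x \<Longrightarrow> 0 \<le> y \<Longrightarrow> \<phi> (x + y) = \<phi> x + \<phi> y"
    and scale: "\<And>c x. 0 \<le> c \<Longrightarrow> 0 \<le> x \<Longrightarrow> \<phi> (c *\<^sub>R x) = c * \<phi> x"
    and bound: "\<And>x. 0 \<le> x \<Longrightarrow> \<bar>\<phi> x\<bar> \<le> C * norm x"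
  obtains g :: "'a \<Rightarrow>\<^sub>L real" where "\<And>x. 0 \<le> x \<Longrightarrow> g x = \<phi> x"
proof -
  define g where "g x = \<phi> (pprt x) - \<phi> (pprt (- x))" for x
  have g_diff: "g (a - b) = \<phi> a - \<phi> b" if "0 \<le> a" "0 \<le> b" for a b
  proof -
    have "pprt (a - b) + b = a + pprt (- (a - b))"
      using pprt_minus_pprt[of "a - b"] by (simp add: algebra_simps)
    then have "\<phi> (pprt (a - b)) + \<phi> b = \<phi> a + \<phi> (pprt (- (a - b)))"
      using that add by (metis zero_le_pprt)
    then show ?thesis by (simp add: g_def)
  qed
  have "bounded_linear g"
  proof (rule bounded_linear_intro)
    fix x y :: 'a
    have "x + y = (pprt x + pprt y) - (pprt (- x) + pprt (- y))"
      using pprt_minus_pprt[of x] pprt_minus_pprt[of y] by (simp add: algebra_simps)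
    then have "g (x + y) = \<phi> (pprt x + pprt y) - \<phi> (pprt (- x) + pprt (- y))"
      using g_diff by (metis add_nonneg_nonneg zero_le_pprt)
    then show "g (x + y) = g x + g y" by (simp add: add g_def)
  next
    fix c :: real and x :: 'a
    show "g (c *\<^sub>R x) = c *\<^sub>R g x"
    proof (cases "0 \<le> c")
      case True
      have "c *\<^sub>R x = c *\<^sub>R pprt x - c *\<^sub>R pprt (- x)"
        using pprt_minus_pprt[of x] by (metis scaleR_diff_right)
      then have "g (c *\<^sub>R x) = \<phi> (c *\<^sub>R pprt x) - \<phi> (c *\<^sub>R pprt (- x))"
        using g_diff True by (metis scaleR_nonneg_nonneg zero_le_pprt)
      then show ?thesis using True by (simp add: scale g_def algebra_simps)
    next
      case False
      have "c *\<^sub>R x = (- c) *\<^sub>R pprt (- x) - (- c) *\<^sub>R pprt x"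
        using pprt_minus_pprt[of x] by (metis minus_diff_eq scaleR_diff_right scaleR_minus_left scaleR_minus_right minus_minus)
      moreover have "0 \<le> - c" using False by simp
      ultimately have "g (c *\<^sub>R x) = \<phi> ((- c) *\<^sub>R pprt (- x)) - \<phi> ((- c) *\<^sub>R pprt x)"
        using g_diff by (metis scaleR_nonneg_nonneg zero_le_pprt)
      then show ?thesis using False scale[of "- c" "pprt x"] scale[of "- c" "pprt (- x)"]
        by (simp add: g_def algebra_simps)
    qed
  next
    fix x :: 'a
    \<comment> \<open>The sign of \<open>C\<close> is unknown, hence \<open>\<bar>C\<bar>\<close>;
      the two parts of \<open>x\<close> account for the factor \<open>2\<close>.\<close>
    have "\<bar>\<phi> (pprt y)\<bar> \<le> \<bar>C\<bar> * norm y" for y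
    proof -
      have "\<bar>\<phi> (pprt y)\<bar> \<le> C * norm (pprt y)" by (rule bound) simp
      also have "\<dots> \<le> \<bar>C\<bar> * norm (pprt y)" by (intro mult_right_mono) simp_all
      also have "\<dots> \<le> \<bar>C\<bar> * norm y"
        by (intro mult_left_mono norm_lattice_mono) (simp_all add: pprt_le_abs)
      finally show ?thesis .
    qed
    from this[of x] this[of "- x"] abs_triangle_ineq4[of "\<phi> (pprt x)" "\<phi> (pprt (- x))"]
    show "norm (g x) \<le> norm x * (2 * \<bar>C\<bar>)" by (simp add: g_def ac_simps)
  qed
  then have "Blinfun g x = \<phi> x" if "0 \<le> x" for x
    using g_diff[OF that order_refl] scale[of 0 0] by (simp add: bounded_linear_Blinfun_apply)
  then show ?thesis by (rule that)
qed

lemma blinfun_le_on_interval: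
  fixes f :: "'a::banach_lattice \<Rightarrow>\<^sub>L real"
  assumes z: "\<bar>z\<bar> \<le> y"
  shows "f z \<le> norm f * norm y"
proof -
  have "norm z \<le> norm y" using norm_mono_nonneg[OF abs_ge_zero z] norm_abs_lattice by metis
  then have "norm f * norm z \<le> norm f * norm y" by (rule mult_left_mono) simp
  then show ?thesis using norm_blinfun[of f z] by simp
qed

section \<open>Order ideals and the Riesz-Kantorovich formula\<close>

definition order_ideal :: "'a::banach_lattice set \<Rightarrow> bool"
  where "order_ideal A \<longleftrightarrow> subspace A \<and> (\<forall>x y. y \<in> A \<longrightarrow> \<bar>x\<bar> \<le> \<bar>y\<bar> \<longrightarrow> x \<in> A)"

text \<open>
  For \<open>y \<ge> 0\<close> this is the modulus of \<open>f\<close> when \<open>A\<close> is the whole space, and the component of \<open>f\<close>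
  carried by \<open>A\<close> when \<open>f \<ge> 0\<close>; one proof of additivity covers both.
\<close>

definition ideal_modulus :: "('a::banach_lattice \<Rightarrow>\<^sub>L real) \<Rightarrow> 'a set \<Rightarrow> 'a \<Rightarrow> real"
  where "ideal_modulus f A y = (SUP z\<in>{z \<in> A. \<bar>z\<bar> \<le> y}. f z)"

context
  fixes f :: "'a::banach_lattice \<Rightarrow>\<^sub>L real" and A :: "'a set"
  assumes A: "order_ideal A"
begin

lemma ideal_modulus_upper: "z \<in> A \<Longrightarrow> \<bar>z\<bar> \<le> y \<Longrightarrow> f z \<le> ideal_modulus f A y"
  unfolding ideal_modulus_def
  by (rule cSUP_upper) (auto intro!: bdd_aboveI blinfun_le_on_interval)

lemma ideal_modulus_least:
  assumes "0 \<le> y" "\<And>z. z \<in> A \<Longrightarrow> \<bar>z\<bar> \<le> y \<Longrightarrow> f z \<le> b"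
  shows "ideal_modulus f A y \<le> b"
proof -
  have "0 \<in> A" using A by (simp add: order_ideal_def subspace_0)
  then have "{z \<in> A. \<bar>z\<bar> \<le> y} \<noteq> {}" using assms(1) by force
  then show ?thesis unfolding ideal_modulus_def using assms(2) by (intro cSUP_least) auto
qed

lemma ideal_modulus_nonneg: "0 \<le> y \<Longrightarrow> 0 \<le> ideal_modulus f A y"
  using ideal_modulus_upper[of 0 y] A by (simp add: order_ideal_def subspace_0)

lemma ideal_modulus_scale_le:
  assumes "0 \<le> c" "0 \<le> y"
  shows "c * ideal_modulus f A y \<le> ideal_modulus f A (c *\<^sub>R y)"
proof (cases "c = 0")
  case True
  then show ?thesis using ideal_modulus_nonneg[of 0] by simp
next
  case False
  with assms have c: "0 < c" by simp
  have "ideal_modulus f A y \<le> ideal_modulus f A (c *\<^sub>R y) / c"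
  proof (rule ideal_modulus_least[OF assms(2)])
    fix z assume z: "z \<in> A" "\<bar>z\<bar> \<le> y"
    have "\<bar>c *\<^sub>R z\<bar> \<le> c *\<^sub>R y"
      using abs_scaleR_le[of c z] scaleR_left_mono[OF z(2) assms(1)] assms(1) by simp
    moreover have "c *\<^sub>R z \<in> A" using A z(1) by (simp add: order_ideal_def subspace_scale)
    ultimately have "f (c *\<^sub>R z) \<le> ideal_modulus f A (c *\<^sub>R y)" by (intro ideal_modulus_upper)
    then show "f z \<le> ideal_modulus f A (c *\<^sub>R y) / c"
      using c by (simp add: blinfun.scaleR_right field_simps)
  qed
  then show ?thesis using c by (simp add: field_simps)
qed

text \<open>Splitting a competitor \<open>z\<close> for \<open>x + y\<close> by Riesz decomposition
  gives one half of additivity; the pieces stay in \<open>A\<close> because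
  \<open>\<bar>z\<bar>\<close> dominates them. Adding competitors gives the other half.\<close>

lemma riesz_kantorovich:
  obtains g :: "'a \<Rightarrow>\<^sub>L real" where "\<And>y. 0 \<le> y \<Longrightarrow> g y = ideal_modulus f A y"
proof (rule cone_functional_extension[of "ideal_modulus f A" "norm f"])
  fix x y :: 'a assume xy: "0 \<le> x" "0 \<le> y"
  have "ideal_modulus f A (x + y) \<le> ideal_modulus f A x + ideal_modulus f A y"
  proof (rule ideal_modulus_least)
    fix z assume z: "z \<in> A" "\<bar>z\<bar> \<le> x + y"
    obtain a b where ab: "z = a + b" "\<bar>a\<bar> \<le> x" "\<bar>b\<bar> \<le> y" "\<bar>a\<bar> \<le> \<bar>z\<bar>" "\<bar>b\<bar> \<le> \<bar>z\<bar>"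
      using riesz_decomposition[OF z(2) xy] by blast
    then have "a \<in> A" "b \<in> A" using A z(1) unfolding order_ideal_def by blast+
    then show "f z \<le> ideal_modulus f A x + ideal_modulus f A y"
      using ab by (simp add: blinfun.add_right add_mono ideal_modulus_upper)
  qed (use xy in simp)
  moreover have "ideal_modulus f A x + ideal_modulus f A y \<le> ideal_modulus f A (x + y)"
  proof -
    have le: "f a + f b \<le> ideal_modulus f A (x + y)"
      if "a \<in> A" "\<bar>a\<bar> \<le> x" "b \<in> A" "\<bar>b\<bar> \<le> y" for a b
    proof -
      have "\<bar>a + b\<bar> \<le> x + y" using that abs_triangle_ineq[of a b] add_mono by (meson order_trans)
      moreover have "a + b \<in> A" using A that by (simp add: order_ideal_def subspace_add)
      ultimately show ?thesis using ideal_modulus_upper[of "a + b"] by (simp add: blinfun.add_right)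
    qed
    have "ideal_modulus f A x \<le> ideal_modulus f A (x + y) - f b" if "b \<in> A" "\<bar>b\<bar> \<le> y" for b
      using le[OF _ _ that] by (intro ideal_modulus_least[OF xy(1)]) (simp add: le_diff_eq)
    then have "ideal_modulus f A y \<le> ideal_modulus f A (x + y) - ideal_modulus f A x"
      by (intro ideal_modulus_least[OF xy(2)]) (simp add: le_diff_eq add.commute)
    then show ?thesis by simp
  qed
  ultimately show "ideal_modulus f A (x + y) = ideal_modulus f A x + ideal_modulus f A y" by simp
next
  fix c :: real and y :: 'a assume cy: "0 \<le> c" "0 \<le> y"
  show "ideal_modulus f A (c *\<^sub>R y) = c * ideal_modulus f A y"
  proof (cases "c = 0")
    case True
    have "ideal_modulus f A 0 \<le> 0" by (rule ideal_modulus_least) simp_all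
    then show ?thesis using True ideal_modulus_nonneg[of 0] by simp
  next
    case False
    with cy have c: "0 < c" by simp
    \<comment> \<open>The reverse inequality is the same one with factor \<open>1 / c\<close> at
      \<open>c *\<^sub>R y\<close>.\<close>
    have "(1 / c) * ideal_modulus f A (c *\<^sub>R y) \<le> ideal_modulus f A ((1 / c) *\<^sub>R (c *\<^sub>R y))"
      using c cy by (intro ideal_modulus_scale_le scaleR_nonneg_nonneg) simp_all
    then have "ideal_modulus f A (c *\<^sub>R y) \<le> c * ideal_modulus f A y"
      using c by (simp add: field_simps)
    then show ?thesis using ideal_modulus_scale_le[OF cy] by simp
  qed
next
  fix y :: 'a assume y: "0 \<le> y"
  have "ideal_modulus f A y \<le> norm f * norm y"
    by (rule ideal_modulus_least[OF y]) (rule blinfun_le_on_interval)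
  then show "\<bar>ideal_modulus f A y\<bar> \<le> norm f * norm y" using ideal_modulus_nonneg[OF y] by simp
qed (rule that)

end

lemma positive_mono:
  fixes f :: "'a::banach_lattice \<Rightarrow>\<^sub>L real"
  assumes "0 \<le> f" "x \<le> y"
  shows "f x \<le> f y"
proof -
  have "0 \<le> f (y - x)" using assms by (simp add: less_eq_blinfun_def)
  then show ?thesis by (simp add: blinfun.diff_right)
qed

text \<open>The ideal is the whole space, and \<open>x\<close> and \<open>- x\<close> are the
  competitors. This lets arbitrary functionals be replaced by positive ones in estimates.\<close>

lemma blinfun_modulus:
  fixes f :: "'a::banach_lattice \<Rightarrow>\<^sub>L real"
  obtains g :: "'a \<Rightarrow>\<^sub>L real" where "0 \<le> g" "\<And>x. \<bar>f x\<bar> \<le> g \<bar>x\<bar>"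
proof -
  have U: "order_ideal (UNIV :: 'a set)" by (simp add: order_ideal_def)
  obtain g :: "'a \<Rightarrow>\<^sub>L real" where g: "\<And>y. 0 \<le> y \<Longrightarrow> g y = ideal_modulus f UNIV y"
    using riesz_kantorovich[OF U, of f] by blast
  have "0 \<le> g" using ideal_modulus_nonneg[OF U] by (simp add: less_eq_blinfun_def g)
  moreover have "\<bar>f x\<bar> \<le> g \<bar>x\<bar>" for x
    using ideal_modulus_upper[OF U, of x "\<bar>x\<bar>" f] ideal_modulus_upper[OF U, of "- x" "\<bar>x\<bar>" f]
    by (simp add: g blinfun.minus_right)
  ultimately show ?thesis by (rule that)
qed

section \<open>Disjoint sequences and almost order boundedness\<close>

definition disjoint_sequence :: "(nat \<Rightarrow> 'a::banach_lattice) \<Rightarrow> bool"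
  where "disjoint_sequence w \<longleftrightarrow>
    (\<forall>n. 0 \<le> w n) \<and> (\<forall>m n. m < n \<longrightarrow> inf (w m) (w n) = 0)"

text \<open>The name refers to the unit ball: for positive \<open>f\<close>, its positive part lies
  within \<open>e\<close> of the order interval from \<open>0\<close> to \<open>u\<close> in the
  seminorm \<open>f \<bar>y\<bar>\<close>.\<close>

definition almost_order_bounded :: "('a::banach_lattice \<Rightarrow>\<^sub>L real) \<Rightarrow> bool"
  where "almost_order_bounded f \<longleftrightarrow>
    (\<forall>e>0. \<exists>u\<ge>0. \<forall>x\<ge>0. norm x \<le> 1 \<longrightarrow> f (pprt (x - u)) \<le> e)"

section \<open>Order continuity of the dual and disjoint sequences\<close>

lemma order_ideal_generated:
  fixes s :: "'a::banach_lattice"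
  assumes "0 \<le> s"
  shows "order_ideal {z. \<exists>t\<ge>0. \<bar>z\<bar> \<le> t *\<^sub>R s}"
proof -
  have "subspace {z. \<exists>t\<ge>0. \<bar>z\<bar> \<le> t *\<^sub>R s}"
  proof (rule subspaceI)
    show "0 \<in> {z. \<exists>t\<ge>0. \<bar>z\<bar> \<le> t *\<^sub>R s}" by (auto intro!: exI[of _ 0])
  next
    fix x y assume "x \<in> {z. \<exists>t\<ge>0. \<bar>z\<bar> \<le> t *\<^sub>R s}" "y \<in> {z. \<exists>t\<ge>0. \<bar>z\<bar> \<le> t *\<^sub>R s}"
    then obtain t r where tr: "0 \<le> t" "\<bar>x\<bar> \<le> t *\<^sub>R s" "0 \<le> r" "\<bar>y\<bar> \<le> r *\<^sub>R s" by blast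
    have "\<bar>x + y\<bar> \<le> (t + r) *\<^sub>R s"
      using abs_triangle_ineq[of x y] add_mono[OF tr(2,4)] by (simp add: scaleR_add_left)
    then show "x + y \<in> {z. \<exists>t\<ge>0. \<bar>z\<bar> \<le> t *\<^sub>R s}" using tr by (auto intro!: exI[of _ "t + r"])
  next
    fix c x assume "x \<in> {z. \<exists>t\<ge>0. \<bar>z\<bar> \<le> t *\<^sub>R s}"
    then obtain t where t: "0 \<le> t" "\<bar>x\<bar> \<le> t *\<^sub>R s" by blast
    have "\<bar>c *\<^sub>R x\<bar> \<le> (\<bar>c\<bar> * t) *\<^sub>R s"
      using abs_scaleR_le[of c x] scaleR_left_mono[OF t(2), of "\<bar>c\<bar>"] by simp
    then show "c *\<^sub>R x \<in> {z. \<exists>t\<ge>0. \<bar>z\<bar> \<le> t *\<^sub>R s}"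
      using t(1) by (auto intro!: exI[of _ "\<bar>c\<bar> * t"])
  qed
  then show ?thesis unfolding order_ideal_def by (auto intro: order_trans)
qed

lemma order_ideal_chain_UN:
  fixes A :: "nat \<Rightarrow> 'a::banach_lattice set"
  assumes A: "\<And>n. order_ideal (A n)" and mono: "\<And>m n. m \<le> n \<Longrightarrow> A m \<subseteq> A n"
  shows "order_ideal (\<Union>n. A n)"
proof -
  have sub: "subspace (A n)" for n using A by (simp add: order_ideal_def)
  have "subspace (\<Union>n. A n)"
  proof (rule subspaceI)
    show "0 \<in> (\<Union>n. A n)" using subspace_0[OF sub] by blast
  next
    fix x y assume "x \<in> (\<Union>n. A n)" "y \<in> (\<Union>n. A n)"
    then obtain m n where "x \<in> A m" "y \<in> A n" by blast
    then have "x \<in> A (max m n)" "y \<in> A (max m n)"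
      using mono[of m "max m n"] mono[of n "max m n"] by auto
    then show "x + y \<in> (\<Union>n. A n)" using subspace_add[OF sub] by blast
  next
    fix c x assume "x \<in> (\<Union>n. A n)"
    then show "c *\<^sub>R x \<in> (\<Union>n. A n)" using subspace_scale[OF sub] by blast
  qed
  moreover have "x \<in> (\<Union>n. A n)" if "y \<in> (\<Union>n. A n)" "\<bar>x\<bar> \<le> \<bar>y\<bar>" for x y
    using A that unfolding order_ideal_def by blast
  ultimately show ?thesis unfolding order_ideal_def by blast
qed

lemma directed_index_nat: "directed_index (UNIV :: nat set) (\<le>)"
  unfolding directed_index_def
proof (intro conjI ballI impI)
  fix i j :: nat
  show "\<exists>k\<in>UNIV. i \<le> k \<and> j \<le> k" by (rule bexI[of _ "max i j"]) simp_all
qed simp_all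

lemma tails_nat: "tails (UNIV :: nat set) (\<le>) = sequentially"
  by (rule filter_eqI) (simp add: eventually_tails[OF directed_index_nat] eventually_sequentially)

text \<open>
  The restrictions (in the sense of \<open>ideal_modulus\<close>) of \<open>f\<close> to the ideals generated by the
  first \<open>N\<close> terms increase to its restriction to their union, and the \<open>N\<close>-th difference
  dominates \<open>f\<close> at the \<open>N\<close>-th term.
\<close>

lemma order_continuous_dual_disjoint:
  fixes f :: "'a::banach_lattice \<Rightarrow>\<^sub>L real"
  assumes oc: "order_continuous_norm TYPE('a \<Rightarrow>\<^sub>L real)" and f: "0 \<le> f"
    and w: "disjoint_sequence w" and bdd: "bounded (range w)"
  shows "(\<lambda>n. f (w n)) \<longlonglongrightarrow> 0"
proof -
  have pos: "0 \<le> w n" and disj: "m < n \<Longrightarrow> inf (w m) (w n) = 0" for m n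
    using w by (auto simp: disjoint_sequence_def)
  obtain C where C: "\<And>n. norm (w n) \<le> C" using bdd by (auto simp: bounded_iff)
  \<comment> \<open>The sum stops before \<open>w N\<close>: thus \<open>w N\<close> is disjoint
    from \<open>s N\<close> but lies in \<open>A (Suc N)\<close>.\<close>
  define s where "s N = (\<Sum>k<N. w k)" for N
  have s: "0 \<le> s N" for N by (simp add: s_def sum_nonneg pos)
  have s_mono: "s m \<le> s n" if "m \<le> n" for m n
    unfolding s_def using that pos by (intro sum_mono2) auto
  define A where "A N = {z. \<exists>t\<ge>0. \<bar>z\<bar> \<le> t *\<^sub>R s N}" for N
  define B where "B = (\<Union>N. A N)"
  have A: "order_ideal (A N)" for N unfolding A_def by (rule order_ideal_generated[OF s])
  have A_mono: "A m \<subseteq> A n" if "m \<le> n" for m n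
    unfolding A_def using scaleR_left_mono[OF s_mono[OF that]] by (blast intro: order_trans)
  have B: "order_ideal B" unfolding B_def using A A_mono by (rule order_ideal_chain_UN)
  have "\<exists>g :: 'a \<Rightarrow>\<^sub>L real. \<forall>y\<ge>0. g y = ideal_modulus f (A N) y" for N
    using riesz_kantorovich[OF A, of f N] by metis
  then obtain q :: "nat \<Rightarrow> 'a \<Rightarrow>\<^sub>L real" where q: "\<And>N y. 0 \<le> y \<Longrightarrow> q N y = ideal_modulus f (A N) y"
    by metis
  obtain p :: "'a \<Rightarrow>\<^sub>L real" where p: "\<And>y. 0 \<le> y \<Longrightarrow> p y = ideal_modulus f B y"
    using riesz_kantorovich[OF B, of f] by blast
  have q_mono: "q m y \<le> q n y" if "m \<le> n" "0 \<le> y" for m n y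
    unfolding q[OF that(2)] using A_mono[OF that(1)] that(2)
    by (intro ideal_modulus_least[OF A] ideal_modulus_upper[OF A]) auto
  have q_le: "q n y \<le> p y" if "0 \<le> y" for n y
    unfolding q[OF that] p[OF that] using that
    by (intro ideal_modulus_least[OF A] ideal_modulus_upper[OF B]) (auto simp: B_def)
  define r where "r N = p - q N" for N
  have "decreasing_to_zero UNIV (\<le>) r"
    unfolding decreasing_to_zero_def
  proof (intro conjI ballI impI allI)
    fix m n :: nat assume "m \<le> n"
    then show "r n \<le> r m" using q_mono by (simp add: r_def less_eq_blinfun_def blinfun.diff_left)
  next
    fix n show "0 \<le> r n" using q_le by (simp add: r_def less_eq_blinfun_def blinfun.diff_left)
  next
    fix z :: "'a \<Rightarrow>\<^sub>L real" assume z: "\<forall>n\<in>UNIV. z \<le> r n"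
    have "z y \<le> 0" if y: "0 \<le> y" for y
    proof -
      have zy: "q n y \<le> p y - z y" for n
      proof -
        have "z y \<le> r n y" using z y by (simp add: less_eq_blinfun_def)
        then show ?thesis by (simp add: r_def blinfun.diff_left)
      qed
      \<comment> \<open>Every \<open>v\<close> in \<open>B\<close> already lies in some
        \<open>A n\<close>, so \<open>p y - z y\<close> bounds every competing \<open>f v\<close>
        and hence their supremum \<open>p y\<close>.\<close>
      have "p y \<le> p y - z y"
        unfolding p[OF y]
      proof (rule ideal_modulus_least[OF B y])
        fix v assume "v \<in> B" "\<bar>v\<bar> \<le> y"
        then obtain n where "v \<in> A n" by (auto simp: B_def)
        then have "f v \<le> q n y" unfolding q[OF y] using \<open>\<bar>v\<bar> \<le> y\<close> by (rule ideal_modulus_upper[OF A])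
        also have "\<dots> \<le> p y - z y" by (rule zy)
        finally show "f v \<le> ideal_modulus f B y - z y" by (simp add: p[OF y])
      qed
      then show ?thesis by simp
    qed
    then show "z \<le> 0" by (simp add: less_eq_blinfun_def)
  qed
  from order_continuous_norm_net[OF oc directed_index_nat this]
  have r_lim: "(\<lambda>N. norm (r N)) \<longlonglongrightarrow> 0" by (simp add: tails_nat)
  have le: "f (w N) \<le> norm (r N) * C" for N
  proof -
    have "w N \<in> A (Suc N)"
      unfolding A_def using s[of N] pos[of N] by (auto simp: s_def intro!: exI[of _ 1])
    then have "f (w N) \<le> p (w N)"
      unfolding p[OF pos] using pos by (intro ideal_modulus_upper[OF B]) (auto simp: B_def)
    \<comment> \<open>Elements of \<open>A N\<close> dominated by \<open>w N\<close> vanish by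
      disjointness.\<close>
    moreover have "q N (w N) \<le> 0"
      unfolding q[OF pos]
    proof (rule ideal_modulus_least[OF A pos])
      fix z assume z: "z \<in> A N" "\<bar>z\<bar> \<le> w N"
      then obtain t where t: "0 \<le> t" "\<bar>z\<bar> \<le> t *\<^sub>R s N" by (auto simp: A_def)
      have "inf (s N) (w N) = 0"
        unfolding s_def using pos disj by (intro inf_sum_eq_0) auto
      then have "inf (t *\<^sub>R s N) (w N) = 0" using t(1) s pos by (intro inf_scaleR_eq_0)
      then have "\<bar>z\<bar> \<le> 0" using t(2) z(2) by (metis le_inf_iff)
      then show "f z \<le> 0" by simp
    qed
    ultimately have "f (w N) \<le> r N (w N)" by (simp add: r_def blinfun.diff_left)
    also have "\<dots> \<le> norm (r N) * norm (w N)" using norm_blinfun[of "r N" "w N"] by simp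
    also have "\<dots> \<le> norm (r N) * C" by (intro mult_left_mono C) simp
    finally show ?thesis .
  qed
  have f_pos: "0 \<le> f (w N)" for N using f pos by (simp add: less_eq_blinfun_def)
  have "(\<lambda>N. norm (r N) * C) \<longlonglongrightarrow> 0" using tendsto_mult_right[OF r_lim, of C] by simp
  then show ?thesis
    using f_pos le by (intro tendsto_sandwich[OF _ _ tendsto_const, of 0 "\<lambda>N. f (w N)"]) simp_all
qed

section \<open>Disjointification\<close>

lemma summable_term_le_suminf:
  fixes a :: "nat \<Rightarrow> 'a::banach_lattice"
  assumes a: "summable a" and pos: "\<And>n. 0 \<le> a n"
  shows "a k \<le> suminf a"
proof -
  have "(\<lambda>N. (\<Sum>n<N. a n) - a k) \<longlonglongrightarrow> suminf a - a k"
    by (intro tendsto_diff tendsto_const summable_LIMSEQ a)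
  moreover have "eventually (\<lambda>N. 0 \<le> (\<Sum>n<N. a n) - a k) sequentially"
    using eventually_gt_at_top[of k]
  proof eventually_elim
    case (elim N)
    then have "(\<Sum>n\<in>{k}. a n) \<le> (\<Sum>n<N. a n)" using pos by (intro sum_mono2) auto
    then show ?case by simp
  qed
  ultimately have "0 \<le> suminf a - a k" by (rule nonneg_limit) simp
  then show ?thesis by simp
qed

text \<open>
  The terms \<open>x n\<close> are chosen so that \<open>f\<close> stays large on \<open>(x n - 4 ^ n (x 0 + \<dots> + x (n - 1)))\<^sup>+\<close>;
  subtracting also \<open>2\<^sup>-\<^sup>n y\<close> with \<open>y = \<Sum>k. 2\<^sup>-\<^sup>k x k\<close> makes these disjoint, as for \<open>m < n\<close> the two
  terms are dominated by multiples of \<open>v\<^sup>+\<close> and \<open>v\<^sup>-\<close> for \<open>v = x m - 4\<^sup>-\<^sup>n x n\<close>.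
\<close>

lemma almost_order_bounded_if_disjoint:
  fixes f :: "'a::banach_lattice \<Rightarrow>\<^sub>L real"
  assumes f: "0 \<le> f"
    and disj: "\<And>w. disjoint_sequence w \<Longrightarrow> bounded (range w) \<Longrightarrow> (\<lambda>n. f (w n)) \<longlonglongrightarrow> 0"
  shows "almost_order_bounded f"
proof (rule ccontr)
  assume "\<not> almost_order_bounded f"
  then obtain e where e: "0 < e"
    and "\<forall>u\<ge>0. \<exists>x\<ge>0. norm x \<le> 1 \<and> e < f (pprt (x - u))"
    unfolding almost_order_bounded_def by (auto simp: not_le)
  then obtain X where X: "\<And>u. 0 \<le> u \<Longrightarrow> 0 \<le> X u" "\<And>u. 0 \<le> u \<Longrightarrow> norm (X u) \<le> 1"
    "\<And>u. 0 \<le> u \<Longrightarrow> e < f (pprt (X u - u))" by metis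
  \<comment> \<open>The sum of the \<open>x k\<close> with \<open>k < n\<close>. The recursion runs
    on these sums because \<open>x n\<close> is chosen from \<open>n\<close> and \<open>S n\<close>
    alone.\<close>
  define S where "S = rec_nat 0 (\<lambda>n s. s + X (4 ^ n *\<^sub>R s))"
  define x where "x n = X (4 ^ n *\<^sub>R S n)" for n
  have S0: "S 0 = 0" and SSuc: "S (Suc n) = S n + x n" for n by (simp_all add: S_def x_def)
  have S: "0 \<le> S n" for n
    by (induction n) (simp_all add: S0 SSuc x_def X(1) scaleR_nonneg_nonneg)
  have x: "0 \<le> x n" "norm (x n) \<le> 1" "e < f (pprt (x n - 4 ^ n *\<^sub>R S n))" for n
    using X S by (simp_all add: x_def scaleR_nonneg_nonneg)
  have x_le_S: "x m \<le> S n" if "m < n" for m n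
    using that
  proof (induction n)
    case (Suc n)
    then show ?case using S[of n] x(1)[of n] by (cases "m = n") (auto simp: SSuc intro: add_increasing add_increasing2)
  qed simp
  \<comment> \<open>The weights make the series absolutely convergent; its sum \<open>y\<close> is
    an upper bound of all \<open>a k\<close>.\<close>
  define a where "a k = (1 / 2) ^ k *\<^sub>R x k" for k
  have a_pos: "0 \<le> a k" for k by (simp add: a_def scaleR_nonneg_nonneg x(1))
  have "summable a"
  proof (rule summable_comparison_test')
    show "summable (\<lambda>k. (1 / 2 :: real) ^ k)" by (rule summable_geometric) simp
    show "norm (a k) \<le> (1 / 2) ^ k" if "0 \<le> k" for k
      using x(2)[of k] by (simp add: a_def mult_left_le)
  qed
  define y where "y = suminf a"
  have a_le: "a k \<le> y" for k
    unfolding y_def using \<open>summable a\<close> a_pos by (rule summable_term_le_suminf)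
  then have y: "0 \<le> y" using a_pos order_trans by blast
  define w where "w n = pprt (x n - 4 ^ n *\<^sub>R S n - (1 / 2) ^ n *\<^sub>R y)" for n
  have w_le: "w n \<le> x n" for n
    unfolding w_def pprt_def using x(1) S y
    by (simp add: diff_le_eq add_increasing2 scaleR_nonneg_nonneg)
  have "inf (w m) (w n) = 0" if "m < n" for m n
  proof -
    \<comment> \<open>The factor is chosen so that \<open>4 ^ n *\<^sub>R (- v)\<close> is
      \<open>x n - 4 ^ n *\<^sub>R x m\<close>.\<close>
    define v where "v = x m - (1 / 4) ^ n *\<^sub>R x n"
    have "w m \<le> pprt v"
    proof -
      \<comment> \<open>Since \<open>m < n\<close>, the term
        \<open>(1 / 4) ^ n *\<^sub>R x n\<close> is absorbed by the
        \<open>(1 / 2) ^ m *\<^sub>R y\<close> subtracted in \<open>w m\<close>.\<close>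
      have "(1 / 4 :: real) ^ n = (1 / 2) ^ (n + n)" by (simp add: power_add power_mult_distrib[symmetric])
      also have "\<dots> \<le> (1 / 2) ^ (m + n)" using that by (intro power_decreasing) simp_all
      finally have "(1 / 4) ^ n *\<^sub>R x n \<le> (1 / 2) ^ (m + n) *\<^sub>R x n"
        using x(1) by (rule scaleR_right_mono)
      also have "\<dots> = (1 / 2) ^ m *\<^sub>R a n" by (simp add: a_def power_add)
      also have "\<dots> \<le> (1 / 2) ^ m *\<^sub>R y" by (intro scaleR_left_mono a_le) simp
      also have "\<dots> \<le> 4 ^ m *\<^sub>R S m + (1 / 2) ^ m *\<^sub>R y" using S by (simp add: scaleR_nonneg_nonneg)
      finally have "x m - (4 ^ m *\<^sub>R S m + (1 / 2) ^ m *\<^sub>R y) \<le> v"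
        unfolding v_def by (rule diff_left_mono)
      then show ?thesis unfolding w_def by (intro pprt_mono) (simp add: diff_diff_eq)
    qed
    moreover have "w n \<le> 4 ^ n *\<^sub>R pprt (- v)"
    proof -
      have "4 ^ n *\<^sub>R x m \<le> 4 ^ n *\<^sub>R S n" by (intro scaleR_left_mono x_le_S that) simp
      also have "\<dots> \<le> 4 ^ n *\<^sub>R S n + (1 / 2) ^ n *\<^sub>R y" using y by (simp add: scaleR_nonneg_nonneg)
      finally have "x n - (4 ^ n *\<^sub>R S n + (1 / 2) ^ n *\<^sub>R y) \<le> x n - 4 ^ n *\<^sub>R x m"
        by (rule diff_left_mono)
      also have "\<dots> = 4 ^ n *\<^sub>R (- v)"
        by (simp add: v_def scaleR_diff_right power_one_over)
      finally have "w n \<le> pprt (4 ^ n *\<^sub>R (- v))" unfolding w_def by (intro pprt_mono) (simp add: diff_diff_eq)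
      also have "\<dots> \<le> 4 ^ n *\<^sub>R pprt (- v)" by (rule pprt_scaleR_le) simp
      finally show ?thesis .
    qed
    moreover have "inf (4 ^ n *\<^sub>R pprt (- v)) (pprt v) = 0"
      using inf_pprt_pprt_minus[of v] by (intro inf_scaleR_eq_0) (simp_all add: inf_commute)
    ultimately have "inf (w m) (w n) \<le> 0" by (metis inf_commute inf_mono)
    then show ?thesis by (intro antisym) (simp_all add: w_def)
  qed
  then have "disjoint_sequence w" by (simp add: disjoint_sequence_def w_def)
  moreover have "bounded (range w)"
  proof -
    have "norm (w n) \<le> 1" for n
      using norm_mono_nonneg[OF _ w_le, of n] x(2)[of n] by (simp add: w_def)
    then show ?thesis by (auto simp: bounded_iff)
  qed
  ultimately have "(\<lambda>n. f (w n)) \<longlonglongrightarrow> 0" by (rule disj)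
  moreover have "(\<lambda>n. (1 / 2) ^ n * f y) \<longlonglongrightarrow> 0"
    by (rule tendsto_mult_left_zero) (simp add: LIMSEQ_power_zero)
  ultimately have "(\<lambda>n. f (w n) + (1 / 2) ^ n * f y) \<longlonglongrightarrow> 0" using tendsto_add by fastforce
  then have "eventually (\<lambda>n. f (w n) + (1 / 2) ^ n * f y < e) sequentially"
    using e by (rule order_tendstoD(2))
  \<comment> \<open>Subtracting \<open>(1 / 2) ^ n *\<^sub>R y\<close> costs only a null sequence
    under \<open>f\<close>, so the values \<open>f (w n)\<close> cannot tend to
    \<open>0\<close>.\<close>
  moreover have "e < f (w n) + (1 / 2) ^ n * f y" for n
  proof -
    let ?z = "x n - 4 ^ n *\<^sub>R S n"
    have "0 \<le> w n" "?z - (1 / 2) ^ n *\<^sub>R y \<le> w n" by (simp_all add: w_def pprt_def)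
    then have "?z \<le> w n + (1 / 2) ^ n *\<^sub>R y" "0 \<le> w n + (1 / 2) ^ n *\<^sub>R y"
      using y by (simp_all add: diff_le_eq scaleR_nonneg_nonneg)
    then have "pprt ?z \<le> w n + (1 / 2) ^ n *\<^sub>R y" by (simp add: pprt_def)
    then have "f (pprt ?z) \<le> f (w n + (1 / 2) ^ n *\<^sub>R y)" by (rule positive_mono[OF f])
    then show ?thesis using x(3)[of n] by (simp add: blinfun.add_right blinfun.scaleR_right)
  qed
  ultimately have "eventually (\<lambda>n. False) sequentially"
    by (auto elim!: eventually_mono simp: less_le_not_le)
  then show False by simp
qed

section \<open>Unbounded continuous operators\<close>

text \<open>The pointwise infimum \<open>\<phi>\<close> is a limit along the net, hence additive on
  the cone, and a single \<open>g i\<close> bounds it. Its extension \<open>G\<close> is therefore a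
  lower bound of the net in the dual, so \<open>G \<le> 0\<close>.\<close>

lemma decreasing_to_zero_pointwise:
  fixes g :: "'i \<Rightarrow> 'a::banach_lattice \<Rightarrow>\<^sub>L real"
  assumes I: "directed_index I le" and g: "decreasing_to_zero I le g" and u: "0 \<le> u"
  shows "((\<lambda>i. g i u) \<longlongrightarrow> 0) (tails I le)"
proof -
  have dec: "g j y \<le> g i y" if "i \<in> I" "j \<in> I" "le i j" "0 \<le> y" for i j y
    using g that unfolding decreasing_to_zero_def less_eq_blinfun_def by blast
  have pos: "0 \<le> g i y" if "i \<in> I" "0 \<le> y" for i y
    using g that unfolding decreasing_to_zero_def less_eq_blinfun_def by fastforce
  have nonempty: "I \<noteq> {}" using I by (simp add: directed_index_def)
  \<comment> \<open>Reflexivity makes every tail nonempty, so limits along the net are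
    unique.\<close>
  have "\<forall>i\<in>I. le i i" using I by (simp add: directed_index_def)
  then have ntriv: "tails I le \<noteq> bot"
    unfolding trivial_limit_def eventually_tails[OF I] by blast
  define \<phi> where "\<phi> y = (INF i\<in>I. g i y)" for y
  have bdd: "bdd_below ((\<lambda>i. g i y) ` I)" if "0 \<le> y" for y
    using pos that by (intro bdd_belowI[of _ 0]) auto
  have \<phi>_le: "\<phi> y \<le> g i y" if "i \<in> I" "0 \<le> y" for i y
    unfolding \<phi>_def using that by (intro cINF_lower bdd)
  have \<phi>_pos: "0 \<le> \<phi> y" if "0 \<le> y" for y
    unfolding \<phi>_def using that pos nonempty by (intro cINF_greatest)
  have lim: "((\<lambda>i. g i y) \<longlongrightarrow> \<phi> y) (tails I le)" if y: "0 \<le> y" for y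
  proof (rule tendstoI)
    fix e :: real assume "0 < e"
    then have "\<phi> y < \<phi> y + e" by simp
    then obtain i where i: "i \<in> I" "g i y < \<phi> y + e"
      unfolding \<phi>_def using cINF_less_iff[OF nonempty bdd[OF y]] by blast
    have "dist (g j y) (\<phi> y) < e" if "j \<in> I" "le i j" for j
      using dec[OF i(1) that y] \<phi>_le[OF that(1) y] i(2) by (simp add: dist_real_def)
    then show "eventually (\<lambda>j. dist (g j y) (\<phi> y) < e) (tails I le)"
      unfolding eventually_tails[OF I] using i(1) by blast
  qed
  obtain i where i: "i \<in> I" using nonempty by blast
  obtain G :: "'a \<Rightarrow>\<^sub>L real" where G: "\<And>y. 0 \<le> y \<Longrightarrow> G y = \<phi> y"
  proof (rule cone_functional_extension[of \<phi> "norm (g i)"])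
    fix x y :: 'a assume xy: "0 \<le> x" "0 \<le> y"
    have "((\<lambda>i. g i (x + y)) \<longlongrightarrow> \<phi> x + \<phi> y) (tails I le)"
      using tendsto_add[OF lim[OF xy(1)] lim[OF xy(2)]] by (simp add: blinfun.add_right)
    then show "\<phi> (x + y) = \<phi> x + \<phi> y"
      using lim[of "x + y"] xy tendsto_unique[OF ntriv] by simp
  next
    fix c :: real and x :: 'a assume cx: "0 \<le> c" "0 \<le> x"
    have "((\<lambda>i. g i (c *\<^sub>R x)) \<longlongrightarrow> c * \<phi> x) (tails I le)"
      using tendsto_mult_left[OF lim[OF cx(2)], of c] by (simp add: blinfun.scaleR_right)
    then show "\<phi> (c *\<^sub>R x) = c * \<phi> x"
      using lim[of "c *\<^sub>R x"] scaleR_nonneg_nonneg[OF cx] tendsto_unique[OF ntriv] by simp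
  next
    fix x :: 'a assume x: "0 \<le> x"
    show "\<bar>\<phi> x\<bar> \<le> norm (g i) * norm x"
      using \<phi>_pos[OF x] \<phi>_le[OF i x] norm_blinfun[of "g i" x] by simp
  qed (rule that)
  have "\<forall>i\<in>I. G \<le> g i" using \<phi>_le by (simp add: less_eq_blinfun_def G)
  then have "G \<le> 0" using g unfolding decreasing_to_zero_def by blast
  then have "\<phi> u \<le> 0" using u by (simp add: less_eq_blinfun_def G[symmetric])
  then show ?thesis using lim[OF u] \<phi>_pos[OF u] by simp
qed

text \<open>\<open>\<bar>x\<bar>\<close> has the norm of \<open>x\<close>, and positivity gives
  \<open>\<bar>g x\<bar> \<le> g \<bar>x\<bar>\<close>.\<close>

lemma positive_norm_le:
  fixes g :: "'a::banach_lattice \<Rightarrow>\<^sub>L real"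
  assumes g: "0 \<le> g" and b: "\<And>x. 0 \<le> x \<Longrightarrow> norm x \<le> 1 \<Longrightarrow> g x \<le> b"
  shows "norm g \<le> b"
proof (rule norm_blinfun_bound)
  show "0 \<le> b" using b[of 0] by simp
next
  fix x :: 'a
  show "norm (g x) \<le> b * norm x"
  proof (cases "x = 0")
    case False
    have "g ((1 / norm x) *\<^sub>R \<bar>x\<bar>) \<le> b"
      using False by (intro b scaleR_nonneg_nonneg) (simp_all add: norm_abs_lattice)
    then have "g \<bar>x\<bar> \<le> b * norm x" using False by (simp add: blinfun.scaleR_right field_simps)
    moreover have "g x \<le> g \<bar>x\<bar>" "g (- x) \<le> g \<bar>x\<bar>"
      by (rule positive_mono[OF g], simp add: abs_ge_self abs_ge_minus_self)+
    ultimately show ?thesis by (simp add: blinfun.minus_right)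
  qed simp
qed

text \<open>A single \<open>u\<close>, chosen for one member \<open>g i\<close>, serves all later
  \<open>g j\<close>: on the excess over \<open>u\<close> they are dominated by \<open>g i\<close>,
  and on the part below \<open>u\<close> by \<open>g j u\<close>, which tends to
  \<open>0\<close>.\<close>

lemma order_continuous_dual_if_almost_order_bounded:
  assumes aob: "\<And>f :: 'a::banach_lattice \<Rightarrow>\<^sub>L real. 0 \<le> f \<Longrightarrow> almost_order_bounded f"
  shows "order_continuous_norm TYPE('a \<Rightarrow>\<^sub>L real)"
  unfolding order_continuous_norm_def
proof (intro allI impI)
  fix I :: "('a \<Rightarrow>\<^sub>L real) set" and le and g :: "('a \<Rightarrow>\<^sub>L real) \<Rightarrow> 'a \<Rightarrow>\<^sub>L real"
  assume I: "directed_index I le" and g: "decreasing_to_zero I le g"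
  have pos: "0 \<le> g i" if "i \<in> I" for i using g that by (simp add: decreasing_to_zero_def)
  show "((\<lambda>i. norm (g i)) \<longlongrightarrow> 0) (tails I le)"
  proof (rule tendstoI)
    fix e :: real assume e: "0 < e"
    have "I \<noteq> {}" using I by (simp add: directed_index_def)
    then obtain i where i: "i \<in> I" by blast
    obtain u where u: "0 \<le> u"
      and gu: "\<And>x. 0 \<le> x \<Longrightarrow> norm x \<le> 1 \<Longrightarrow> g i (pprt (x - u)) \<le> e / 3"
      using aob[OF pos[OF i]] e unfolding almost_order_bounded_def
      by (metis divide_pos_pos zero_less_numeral)
    have "eventually (\<lambda>j. g j u < e / 3) (tails I le)"
      using decreasing_to_zero_pointwise[OF I g u] e by (intro order_tendstoD(2)[of _ 0]) simp_all
    moreover have "eventually (\<lambda>j. j \<in> I \<and> le i j) (tails I le)"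
      unfolding eventually_tails[OF I] using i by blast
    ultimately show "eventually (\<lambda>j. dist (norm (g j)) 0 < e) (tails I le)"
    proof eventually_elim
      case (elim j)
      have j: "0 \<le> g j" "g j \<le> g i"
        using elim pos i g by (auto simp: decreasing_to_zero_def)
      \<comment> \<open>The bound over the ball is only a weak inequality; thirds of
        \<open>e\<close> leave room for the strict one.\<close>
      have "norm (g j) \<le> 2 * e / 3"
      proof (rule positive_norm_le[OF j(1)])
        fix x :: 'a assume x: "0 \<le> x" "norm x \<le> 1"
        have "g j x = g j (inf x u) + g j (pprt (x - u))"
          by (simp add: inf_add_pprt_diff blinfun.add_right[symmetric])
        also have "\<dots> \<le> g j u + g i (pprt (x - u))"
          using j by (intro add_mono positive_mono) (simp_all add: less_eq_blinfun_def)
        also have "\<dots> \<le> 2 * e / 3" using gu[OF x] elim by simp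
        finally show "g j x \<le> 2 * e / 3" .
      qed
      then show ?case using e by simp
    qed
  qed
qed

text \<open>Each functional \<open>h\<close> on the target gives \<open>h o\<^sub>L T\<close>, which
  a positive \<open>F\<close> dominates. Splitting \<open>\<bar>x i\<bar>\<close> then leaves a
  truncated part, controlled by \<open>uaw\<close> convergence, and a uniformly small
  excess.\<close>

lemma unbounded_continuous_if_almost_order_bounded:
  fixes T :: "'a::banach_lattice \<Rightarrow>\<^sub>L 'b::banach"
  assumes aob: "\<And>f :: 'a \<Rightarrow>\<^sub>L real. 0 \<le> f \<Longrightarrow> almost_order_bounded f"
  shows "unbounded_continuous T"
  unfolding unbounded_continuous_def
proof (intro allI impI)
  fix I :: "('a \<times> 'a set) set" and le and x :: "'a \<times> 'a set \<Rightarrow> 'a"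
  assume I: "directed_index I le" and bdd: "bounded (x ` I)" and uaw: "uaw_tendsto x 0 (tails I le)"
  have nonempty: "I \<noteq> {}" using I by (simp add: directed_index_def)
  obtain C where C: "0 < C" "\<And>i. i \<in> I \<Longrightarrow> norm (x i) \<le> C"
    using bdd by (auto simp: bounded_pos)
  show "weakly_tendsto (\<lambda>i. T (x i)) 0 (tails I le)"
    unfolding weakly_tendsto_def
  proof
    fix h :: "'b \<Rightarrow>\<^sub>L real"
    obtain F :: "'a \<Rightarrow>\<^sub>L real" where F: "0 \<le> F" "\<And>y. \<bar>(h o\<^sub>L T) y\<bar> \<le> F \<bar>y\<bar>"
      using blinfun_modulus[of "h o\<^sub>L T"] by blast
    have "((\<lambda>i. h (T (x i))) \<longlongrightarrow> 0) (tails I le)"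
    proof (rule tendstoI)
      fix e :: real assume e: "0 < e"
      \<comment> \<open>Almost order boundedness concerns the unit ball, so the net is divided by
        \<open>C\<close>; the tolerance \<open>e / (2 * C)\<close> and the level
        \<open>C *\<^sub>R u\<close> undo this.\<close>
      then have "0 < e / (2 * C)" using C by simp
      then obtain u where u: "0 \<le> u"
        and Fu: "\<And>y. 0 \<le> y \<Longrightarrow> norm y \<le> 1 \<Longrightarrow> F (pprt (y - u)) \<le> e / (2 * C)"
        using aob[OF F(1)] unfolding almost_order_bounded_def by metis
      have "0 \<le> C *\<^sub>R u" using C(1) u by (simp add: scaleR_nonneg_nonneg)
      then have "((\<lambda>i. F (inf \<bar>x i\<bar> (C *\<^sub>R u))) \<longlongrightarrow> 0) (tails I le)"
        using uaw by (auto simp: uaw_tendsto_def weakly_tendsto_def)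
      then have "eventually (\<lambda>i. F (inf \<bar>x i\<bar> (C *\<^sub>R u)) < e / 2) (tails I le)"
        using e by (intro order_tendstoD(2)[of _ 0]) simp_all
      moreover have "eventually (\<lambda>i. i \<in> I) (tails I le)"
        unfolding eventually_tails[OF I] using nonempty by blast
      ultimately show "eventually (\<lambda>i. dist (h (T (x i))) 0 < e) (tails I le)"
      proof eventually_elim
        case (elim i)
        define y where "y = (1 / C) *\<^sub>R \<bar>x i\<bar>"
        have y: "0 \<le> y" "norm y \<le> 1" "\<bar>x i\<bar> = C *\<^sub>R y"
          using C elim by (simp_all add: y_def norm_abs_lattice scaleR_nonneg_nonneg)
        have "pprt (\<bar>x i\<bar> - C *\<^sub>R u) \<le> C *\<^sub>R pprt (y - u)"
          using pprt_scaleR_le[of C "y - u"] C(1) by (simp add: y(3) scaleR_diff_right)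
        then have "F (pprt (\<bar>x i\<bar> - C *\<^sub>R u)) \<le> F (C *\<^sub>R pprt (y - u))"
          by (rule positive_mono[OF F(1)])
        also have "\<dots> \<le> C * (e / (2 * C))"
          using mult_left_mono[OF Fu[OF y(1,2)], of C] C(1) by (simp add: blinfun.scaleR_right)
        also have "\<dots> = e / 2" using C(1) by simp
        finally have small: "F (pprt (\<bar>x i\<bar> - C *\<^sub>R u)) \<le> e / 2" .
        have "\<bar>h (T (x i))\<bar> \<le> F \<bar>x i\<bar>" using F(2)[of "x i"] by simp
        also have "\<dots> = F (inf \<bar>x i\<bar> (C *\<^sub>R u)) + F (pprt (\<bar>x i\<bar> - C *\<^sub>R u))"
          by (simp add: inf_add_pprt_diff blinfun.add_right[symmetric])
        also have "\<dots> < e" using elim small by simp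
        finally show ?case by simp
      qed
    qed
    then show "((\<lambda>i. h (T (x i))) \<longlongrightarrow> h 0) (tails I le)" by simp
  qed
qed

lemma unbounded_continuous_imp_sequentially:
  "unbounded_continuous T \<Longrightarrow> sequentially_unbounded_continuous T"
  unfolding sequentially_unbounded_continuous_def
  using unbounded_continuous_net[OF _ directed_index_nat, of T] by (simp add: tails_nat)

text \<open>For a positive \<open>F\<close> dominating \<open>f\<close>, the partial sums of
  \<open>F (inf (w n) u)\<close> are bounded by \<open>F u\<close>, so the series converges and its
  terms tend to \<open>0\<close>.\<close>

lemma disjoint_sequence_uaw_null:
  assumes w: "disjoint_sequence w"
  shows "uaw_tendsto w 0 sequentially"
  unfolding uaw_tendsto_def weakly_tendsto_def
proof (intro allI impI)
  fix u :: 'a and f :: "'a \<Rightarrow>\<^sub>L real" assume u: "0 \<le> u"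
  have pos: "0 \<le> w n" and disj: "m < n \<Longrightarrow> inf (w m) (w n) = 0" for m n
    using w by (auto simp: disjoint_sequence_def)
  obtain F :: "'a \<Rightarrow>\<^sub>L real" where F: "0 \<le> F" "\<And>y. \<bar>f y\<bar> \<le> F \<bar>y\<bar>"
    using blinfun_modulus[of f] by blast
  have F_pos: "0 \<le> F (inf (w n) u)" for n
    using positive_mono[OF F(1), of 0 "inf (w n) u"] pos u by simp
  have "(\<Sum>n<N. F (inf (w n) u)) \<le> F u" for N
    using positive_mono[OF F(1) sum_inf_disjoint_le[OF pos disj u]] by (simp add: blinfun.sum_right)
  then have "summable (\<lambda>n. F (inf (w n) u))"
    using F_pos by (intro summableI_nonneg_bounded[of _ "F u"])
  then have "(\<lambda>n. F (inf (w n) u)) \<longlonglongrightarrow> 0" by (rule summable_LIMSEQ_zero)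
  moreover have le: "\<forall>n. norm (f (inf (w n) u)) \<le> F (inf (w n) u)"
    using F(2)[of "inf (w _) u"] pos u by simp
  ultimately have "(\<lambda>n. f (inf (w n) u)) \<longlonglongrightarrow> 0"
    using Lim_null_comparison[OF always_eventually[OF le]] by blast
  then show "(\<lambda>n. f (inf \<bar>w n - 0\<bar> u)) \<longlonglongrightarrow> f 0" using pos by simp
qed

text \<open>The rank one operator sending \<open>x\<close> to \<open>f x *\<^sub>R a\<close>, tested
  with some \<open>h\<close> such that \<open>h a \<noteq> 0\<close>, recovers
  \<open>f (w n)\<close> up to a nonzero factor. This is where the target has to be nonzero.\<close>

lemma disjoint_null_if_sequentially_unbounded_continuous:
  fixes f :: "'a::banach_lattice \<Rightarrow>\<^sub>L real" and a :: "'b::banach"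
  assumes a: "a \<noteq> 0"
    and suc: "\<And>T :: 'a \<Rightarrow>\<^sub>L 'b. sequentially_unbounded_continuous T"
    and w: "disjoint_sequence w" and bdd: "bounded (range w)"
  shows "(\<lambda>n. f (w n)) \<longlonglongrightarrow> 0"
proof -
  obtain h :: "'b \<Rightarrow>\<^sub>L real" where h: "h a \<noteq> 0" using blinfun_separates_zero[OF a] by blast
  define T :: "'a \<Rightarrow>\<^sub>L 'b" where "T = blinfun_scaleR_left a o\<^sub>L f"
  have "weakly_tendsto (\<lambda>n. T (w n)) 0 sequentially"
    using suc[of T] bdd disjoint_sequence_uaw_null[OF w]
    unfolding sequentially_unbounded_continuous_def by blast
  then have "(\<lambda>n. h (T (w n))) \<longlonglongrightarrow> h 0" unfolding weakly_tendsto_def by blast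
  then have "(\<lambda>n. f (w n) * h a) \<longlonglongrightarrow> 0 * h a"
    by (simp add: T_def blinfun.scaleR_right)
  then show ?thesis using tendsto_mult_right_iff[OF h] by blast
qed

theorem theorem2p16:
  assumes "\<exists>x :: 'x::banach. x \<noteq> 0"
  shows "(order_continuous_norm TYPE('e::banach_lattice \<Rightarrow>\<^sub>L real) \<longleftrightarrow>
            (\<forall>T :: 'e \<Rightarrow>\<^sub>L 'x. unbounded_continuous T)) \<and>
         ((\<forall>T :: 'e \<Rightarrow>\<^sub>L 'x. unbounded_continuous T) \<longleftrightarrow>
            (\<forall>T :: 'e \<Rightarrow>\<^sub>L 'x. sequentially_unbounded_continuous T))"
proof -
  have 12: "unbounded_continuous T"
    if oc: "order_continuous_norm TYPE('e \<Rightarrow>\<^sub>L real)" for T :: "'e \<Rightarrow>\<^sub>L 'x"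
    by (intro unbounded_continuous_if_almost_order_bounded almost_order_bounded_if_disjoint
        order_continuous_dual_disjoint[OF oc])
  have 31: "order_continuous_norm TYPE('e \<Rightarrow>\<^sub>L real)"
    if suc: "\<forall>T :: 'e \<Rightarrow>\<^sub>L 'x. sequentially_unbounded_continuous T"
  proof -
    obtain a :: 'x where a: "a \<noteq> 0" using assms by blast
    show ?thesis
      by (intro order_continuous_dual_if_almost_order_bounded almost_order_bounded_if_disjoint
          disjoint_null_if_sequentially_unbounded_continuous[OF a suc[rule_format]])
  qed
  show ?thesis using 12 31 unbounded_continuous_imp_sequentially by blast
qed

end
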